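(* If a random variable $X$ is of type $\mathscr{L}'$, then the sequence $(r_n)_{n=0}^\infty$ defined by $$r_n = \frac{\mathbb{E}X^{2n}}{\mathbb{E}G^{2n}},\qquad n \geq 0,$$ where $G$ is a standard Gaussian random variable, is log-concave. In particular, type $\mathscr{L}$ random variables are ultra sub-Gaussian.
   Context: A real-valued random variable $X$ is of type $\mathscr{L}'$ if (i) there are positive constants $C, C'$ such that $|\mathbb{E}\exp(zX)| \leq C\exp(C'|z|^2)$ for all $z \in \mathbb{C}$, and (ii') the function $z \mapsto \mathbb{E}\exp(zX)$ on $\mathbb{C}$ has only pure imaginary zeros (it may have no zeros at all). It is of type $\mathscr{L}$ if it satisfies (i) and (ii): $z \mapsto \mathbb{E}\exp(zX)$ is even and has only pure imaginary zeros (possibly none). A nonnegative sequence $(a_n)_{n \geq 0}$ is log-concave if it is supported on a contiguous interval of indices (which may be infinite) and satisfies $a_n^2 \geq a_{n-1}a_{n+1}$ for all $n \geq 1$. A real-valued random variable $X$ is ultra sub-Gaussian if it is symmetric ($-X$ has the same distribution as $X$), has all moments finite, and the sequence $(a_n)_{n=0}^\infty$ with $a_0=1$, $a_n = \mathbb{E}X^{2n}/\mathbb{E}G^{2n}$ for $n\geq 1$, is log-concave. The convention $r_0=1$ is used. *)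

theory Defs
  imports "HOL-Probability.Probability"
begin

definition complex_mgf :: "'a measure \<Rightarrow> ('a \<Rightarrow> real) \<Rightarrow> complex \<Rightarrow> complex" where
  "complex_mgf M X z = (\<integral>\<omega>. exp (z * complex_of_real (X \<omega>)) \<partial>M)"

text \<open>
  The integrability clause expresses that the expectation exists for every complex \<open>z\<close>. It has to be
  stated, since the Bochner integral of a non-integrable function is \<open>0\<close> and would satisfy any bound.
\<close>

definition gaussian_mgf_bound :: "'a measure \<Rightarrow> ('a \<Rightarrow> real) \<Rightarrow> bool" where
  "gaussian_mgf_bound M X \<longleftrightarrow>
     (\<exists>C>0. \<exists>C'>0. \<forall>z::complex.
        integrable M (\<lambda>\<omega>. exp (z * complex_of_real (X \<omega>))) \<and>
        norm (complex_mgf M X z) \<le> C * exp (C' * (norm z)\<^sup>2))"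

definition type_L' :: "'a measure \<Rightarrow> ('a \<Rightarrow> real) \<Rightarrow> bool" where
  "type_L' M X \<longleftrightarrow>
     gaussian_mgf_bound M X \<and>
     (\<forall>z. complex_mgf M X z = 0 \<longrightarrow> Re z = 0)"

definition type_L :: "'a measure \<Rightarrow> ('a \<Rightarrow> real) \<Rightarrow> bool" where
  "type_L M X \<longleftrightarrow>
     gaussian_mgf_bound M X \<and>
     (\<forall>z. complex_mgf M X (- z) = complex_mgf M X z) \<and>
     (\<forall>z. complex_mgf M X z = 0 \<longrightarrow> Re z = 0)"

definition log_concave_seq :: "(nat \<Rightarrow> real) \<Rightarrow> bool" where
  "log_concave_seq a \<longleftrightarrow>
     (\<forall>n. 0 \<le> a n) \<and>
     (\<forall>i j k. i \<le> j \<longrightarrow> j \<le> k \<longrightarrow> a i \<noteq> 0 \<longrightarrow> a k \<noteq> 0 \<longrightarrow> a j \<noteq> 0) \<and>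
     (\<forall>n\<ge>1. a (n - 1) * a (n + 1) \<le> (a n)\<^sup>2)"

text \<open>
  The standard Gaussian \<open>G\<close> is the identity on \<^const>\<open>std_normal_distribution\<close>; by the lemma below
  any other standard Gaussian random variable gives the same moments.
\<close>

definition gaussian_moment_ratio :: "'a measure \<Rightarrow> ('a \<Rightarrow> real) \<Rightarrow> nat \<Rightarrow> real" where
  "gaussian_moment_ratio M X n =
     (\<integral>\<omega>. X \<omega> ^ (2 * n) \<partial>M) / (\<integral>x. x ^ (2 * n) \<partial>std_normal_distribution)"

lemma std_normal_moment_eq:
  assumes "distributed N lborel G std_normal_density"
  shows "(\<integral>\<omega>. G \<omega> ^ k \<partial>N) = (\<integral>x. x ^ k \<partial>std_normal_distribution)"
proof -
  have "(\<integral>x. x ^ k \<partial>std_normal_distribution) = (\<integral>x. std_normal_density x * x ^ k \<partial>lborel)"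
    by (subst integral_density) auto
  also have "\<dots> = (\<integral>\<omega>. G \<omega> ^ k \<partial>N)"
    by (rule distributed_integral[OF assms]) auto
  finally show ?thesis by simp
qed

definition ultra_sub_gaussian :: "'a measure \<Rightarrow> ('a \<Rightarrow> real) \<Rightarrow> bool" where
  "ultra_sub_gaussian M X \<longleftrightarrow>
     distr M borel (\<lambda>\<omega>. - X \<omega>) = distr M borel X \<and>
     (\<forall>k. integrable M (\<lambda>\<omega>. X \<omega> ^ k)) \<and>
     log_concave_seq (\<lambda>n. if n = 0 then 1 else gaussian_moment_ratio M X n)"

end

theory Submission
  imports Defs "HOL-Complex_Analysis.Complex_Analysis" "HOL-Real_Asymp.Real_Asymp"
begin

text \<open>
  Write \<open>f z = E (exp (z X))\<close> and put \<open>w = z\<^sup>2\<close>. Since \<open>E G\<^sup>2\<^sup>n = (2n)! / (2\<^sup>n n!)\<close>, the even part of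
  \<open>f\<close> is \<open>\<Sum>n. r\<^sub>n 2\<^sup>-\<^sup>n w\<^sup>n / n!\<close>, so the claim is a family of Turan inequalities for the coefficients
  of this series. The zeros of \<open>f\<close> are imaginary and come in conjugate pairs, hence Hadamard's theorem
  gives \<open>f z = exp (b z + a z\<^sup>2) \<cdot> \<Prod>k. (1 + z\<^sup>2 / x\<^sub>k\<^sup>2)\<close> with \<open>a\<close> and \<open>b\<close> real. Every factor except
  \<open>exp (b z)\<close> is a function of \<open>w\<close>, and so survives when the even part is taken.

  If \<open>a \<ge> 0\<close>, all of \<open>f\<close> is built from \<open>exp (b z)\<close> by multiplying with factors \<open>1 + \<alpha> w\<close>, where
  \<open>\<alpha> \<ge> 0\<close>, and by passing to locally uniform limits, because \<open>exp (a w)\<close> is the limit of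
  \<open>(1 + a w / m)\<^sup>m\<close>. The inequalities hold for \<open>exp (b z)\<close> (\<open>turan_seq_exp\<close>), and they are
  preserved by such factors (\<open>turan_seq_binomial_step\<close>) and by limits (\<open>turan_seq_limit\<close>).

  The coefficient \<open>a\<close> is nonnegative because \<open>f x + f (-x) \<ge> 2\<close> on the real line, since
  \<open>exp u + exp (-u) \<ge> 2\<close>, while a product with \<open>\<Sum>k. 1 / x\<^sub>k\<^sup>2\<close> finite grows more slowly than any
  \<open>exp (\<epsilon> x\<^sup>2)\<close>: were \<open>a\<close> negative, \<open>f x\<close> and \<open>f (-x)\<close> would both tend to \<open>0\<close>
  (\<open>quadratic_exponent_nonneg\<close>).

  The part of Hadamard's theorem that is required is proved directly
  (\<open>imaginary_zeros_factorization\<close>). Divide \<open>f\<close> by the product \<open>P\<close> over its zeros of modulus at most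
  \<open>m\<close>. On the circle of radius \<open>2m\<close> every factor has modulus at least \<open>1\<close>, so \<open>f / P\<close> is bounded by
  \<open>exp (K m\<^sup>2)\<close> on the disc of radius \<open>m\<close>, where it has no zero and hence a logarithm \<open>q\<close>. A bound
  on \<open>Re q\<close> gives one on \<open>q\<close> by the Schwarz lemma. Cauchy's estimates then bound the second Taylor
  coefficient of \<open>q\<close> independently of \<open>m\<close>, which makes \<open>\<Sum>k. 1 / x\<^sub>k\<^sup>2\<close> converge, and show that the
  part of \<open>q\<close> of order three and higher is \<open>O(1/m)\<close> on compact sets.

  Log-concavity also forbids internal zeros. Here \<open>E X\<^sup>2\<^sup>n = 0\<close> for one \<open>n > 0\<close> forces \<open>X = 0\<close> almost
  surely, and then every moment of positive order vanishes. For type L, evenness of \<open>f\<close> on the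
  imaginary axis says that \<open>X\<close> and \<open>-X\<close> have the same characteristic function.
\<close>


section \<open>Sequences satisfying Turan inequalities\<close>

text \<open>
  The inequalities compare two indices \<open>i \<le> j\<close> that need not be equal. For sequences without
  internal zeros this follows from the case \<open>i = j\<close>, but a limit of such sequences can have internal
  zeros. The inequalities for \<open>i < j\<close> are what \<open>turan_seq_binomial_step\<close> consumes.
\<close>

definition turan_seq :: "(nat \<Rightarrow> real) \<Rightarrow> bool" where
  "turan_seq v \<longleftrightarrow>
     (\<forall>n. 0 \<le> v n) \<and> (\<forall>i j. i \<le> j \<longrightarrow> v i * v (j + 2) \<le> v (i + 1) * v (j + 1))"

lemma turan_seqD:
  assumes "turan_seq v"
  shows "0 \<le> v n" "i \<le> j \<Longrightarrow> v i * v (j + 2) \<le> v (i + 1) * v (j + 1)"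
  using assms by (auto simp: turan_seq_def)

text \<open>
  If \<open>v n\<close> is \<open>n!\<close> times the coefficient of \<open>w\<^sup>n\<close> in a series, the new sequence belongs to
  the series multiplied by \<open>1 + \<alpha> w\<close>. The difference of the two sides of each inequality is a
  quadratic polynomial in \<open>\<alpha>\<close>, and all three of its coefficients are nonnegative.
\<close>

lemma turan_seq_binomial_step:
  assumes v: "turan_seq v" and \<alpha>: "0 \<le> \<alpha>"
  shows "turan_seq (\<lambda>n. v n + \<alpha> * real n * v (n - 1))"
  unfolding turan_seq_def
proof (intro conjI allI impI)
  fix n show "0 \<le> v n + \<alpha> * real n * v (n - 1)"
    using turan_seqD(1)[OF v] \<alpha> by simp
next
  fix i j :: nat assume ij: "i \<le> j"
  note nn = turan_seqD(1)[OF v]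
  have t0: "v i * v (j + 2) \<le> v (i + 1) * v (j + 1)"
    using turan_seqD(2)[OF v ij] .
  have t1: "real i * (v (i - 1) * v (j + 2)) \<le> real i * (v i * v (j + 1))"
  proof (cases i)
    case (Suc k)
    then show ?thesis using turan_seqD(2)[OF v, of k "j"] ij
      by (intro mult_left_mono) auto
  qed auto
  have t2: "v i * v (j + 1) \<le> v (i + 1) * v j"
  proof (cases "i = j")
    case False
    then obtain k where "j = Suc k" "i \<le> k" using ij by (cases j) auto
    then show ?thesis using turan_seqD(2)[OF v, of i k] by simp
  qed auto
  have t3: "real i * (v (i - 1) * v (j + 1)) \<le> real i * (v i * v j)"
  proof (cases i)
    case (Suc k)
    then obtain l where "j = Suc l" "k \<le> l" using ij by (cases j) auto
    then show ?thesis using turan_seqD(2)[OF v, of k l] Suc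
      by (intro mult_left_mono) auto
  qed auto
  \<comment> \<open>The coefficients of \<open>1\<close>, \<open>\<alpha>\<close> and \<open>\<alpha>\<^sup>2\<close>.\<close>
  define A B where "A = v (i + 1) * v (j + 1) - v i * v (j + 2)"
    and "B = (real j + 1) * (v (i + 1) * v j) + (real i + 1) * (v i * v (j + 1))
       - (real j + 2) * (v i * v (j + 1)) - real i * (v (i - 1) * v (j + 2))"
  define C where "C = (real i + 1) * (real j + 1) * (v i * v j)
       - real i * (real j + 2) * (v (i - 1) * v (j + 1))"
  have A: "A \<ge> 0" using t0 by (simp add: A_def)
  have "B \<ge> (real j + 1) * (v (i + 1) * v j - v i * v (j + 1))"
    using t1 unfolding B_def by (simp add: algebra_simps)
  moreover have "(real j + 1) * (v (i + 1) * v j - v i * v (j + 1)) \<ge> 0"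
    using t2 by simp
  ultimately have B: "B \<ge> 0" by linarith
  have "real i * (real j + 2) * (v (i - 1) * v (j + 1)) \<le> (real j + 2) * (real i * (v i * v j))"
    using mult_left_mono[OF t3, of "real j + 2"] by (simp add: algebra_simps)
  also have "\<dots> = (real i * (real j + 2)) * (v i * v j)" by simp
  also have "\<dots> \<le> ((real i + 1) * (real j + 1)) * (v i * v j)"
    using ij nn by (intro mult_right_mono) (auto simp: algebra_simps)
  finally have C: "C \<ge> 0" by (simp add: C_def)
  have "(v (i + 1) + \<alpha> * real (i + 1) * v (i + 1 - 1)) * (v (j + 1) + \<alpha> * real (j + 1) * v (j + 1 - 1))
      - (v i + \<alpha> * real i * v (i - 1)) * (v (j + 2) + \<alpha> * real (j + 2) * v (j + 2 - 1))
      = A + \<alpha> * B + \<alpha>\<^sup>2 * C"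
    unfolding A_def B_def C_def by (simp add: algebra_simps power2_eq_square)
  moreover have "A + \<alpha> * B + \<alpha>\<^sup>2 * C \<ge> 0" using A B C \<alpha> by simp
  ultimately show "(v i + \<alpha> * real i * v (i - 1)) * (v (j + 2) + \<alpha> * real (j + 2) * v (j + 2 - 1))
      \<le> (v (i + 1) + \<alpha> * real (i + 1) * v (i + 1 - 1)) * (v (j + 1) + \<alpha> * real (j + 1) * v (j + 1 - 1))"
    by linarith
qed

lemma turan_seq_limit:
  assumes "\<And>m. turan_seq (v m)" "\<And>n. (\<lambda>m. v m n) \<longlonglongrightarrow> w n"
  shows "turan_seq w"
  unfolding turan_seq_def
proof (intro conjI allI impI)
  fix n show "0 \<le> w n"
    by (rule tendsto_lowerbound[OF assms(2)]) (use turan_seqD(1)[OF assms(1)] in auto)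
next
  fix i j :: nat assume "i \<le> j"
  then show "w i * w (j + 2) \<le> w (i + 1) * w (j + 1)"
    by (intro LIMSEQ_le[OF tendsto_mult[OF assms(2) assms(2)] tendsto_mult[OF assms(2) assms(2)]])
       (use turan_seqD(2)[OF assms(1)] in auto)
qed

text \<open>
  With \<open>t = b\<^sup>2\<close> this is the sequence of \<open>cosh (b z)\<close>, the even part of \<open>exp (b z)\<close>. The ratio of
  consecutive terms is \<open>t / (2 (2 n + 1))\<close>, which decreases in \<open>n\<close>.
\<close>

lemma turan_seq_exp:
  fixes t :: real
  assumes "0 \<le> t"
  shows "turan_seq (\<lambda>n. fact n / fact (2 * n) * t ^ n)"
  unfolding turan_seq_def
proof (intro conjI allI impI)
  fix i j :: nat assume ij: "i \<le> j"
  define s :: "nat \<Rightarrow> real" where "s n = fact n / fact (2 * n)" for n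
  have s0: "s n > 0" for n by (simp add: s_def)
  have s: "s (Suc n) * (2 * (2 * real n + 1)) = s n" for n
  proof -
    have "fact (2 * Suc n) = (2 * (real n + 1)) * (2 * real n + 1) * fact (2 * n)"
      by (simp add: algebra_simps)
    then show ?thesis by (simp add: s_def divide_simps) (simp add: algebra_simps)
  qed
  have "s i * s (j + 2) * (2 * (2 * real (j + 1) + 1)) = s i * s (j + 1)"
    using s[of "j + 1"] by (simp add: mult.assoc)
  also have "\<dots> = s (i + 1) * s (j + 1) * (2 * (2 * real i + 1))"
    using s[of i] by (simp add: mult_ac)
  also have "\<dots> \<le> s (i + 1) * s (j + 1) * (2 * (2 * real (j + 1) + 1))"
    using s0 ij by (intro mult_left_mono) (auto simp: less_imp_le)
  finally have "s i * s (j + 2) \<le> s (i + 1) * s (j + 1)"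
    by (rule mult_right_le_imp_le) auto
  then have "s i * s (j + 2) * t ^ (i + j + 2) \<le> s (i + 1) * s (j + 1) * t ^ (i + j + 2)"
    using assms by (intro mult_right_mono) auto
  then show "fact i / fact (2 * i) * t ^ i * (fact (j + 2) / fact (2 * (j + 2)) * t ^ (j + 2))
    \<le> fact (i + 1) / fact (2 * (i + 1)) * t ^ (i + 1) * (fact (j + 1) / fact (2 * (j + 1)) * t ^ (j + 1))"
    unfolding s_def by (simp add: power_add mult_ac)
qed (use assms in auto)

section \<open>Even Taylor coefficients of entire functions\<close>

lemma fps_expansion_eqI:
  assumes "F has_fps_expansion \<phi>"
  shows "fps_expansion F 0 = \<phi>"
  by (rule fps_ext) (simp add: fps_expansion_def fps_nth_fps_expansion[OF assms])

text \<open>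
  This is \<open>n!\<close> times the coefficient of \<open>w\<^sup>n\<close> in the even part of \<open>F\<close>, written as a series in
  \<open>w = z\<^sup>2\<close>. For the functions considered here the coefficients are real, and taking
  the real part merely changes the type.
\<close>

definition even_coeff :: "(complex \<Rightarrow> complex) \<Rightarrow> nat \<Rightarrow> real" where
  "even_coeff F n = fact n * Re (fps_nth (fps_expansion F 0) (2 * n))"

lemma even_coeff_mult:
  assumes F: "F holomorphic_on UNIV"
  shows "even_coeff (\<lambda>z. (1 + of_real \<alpha> * z\<^sup>2) * F z) n
       = even_coeff F n + \<alpha> * real n * even_coeff F (n - 1)"
proof -
  have F': "F has_fps_expansion fps_expansion F 0"
    by (intro has_fps_expansion_fps_expansion[of UNIV]) (use F in auto)
  have "(\<lambda>z. (1 + of_real \<alpha> * z\<^sup>2) * F z) has_fps_expansion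
      (1 + fps_const (of_real \<alpha>) * fps_X\<^sup>2) * fps_expansion F 0"
    by (intro fps_expansion_intros F')
  then have "fps_expansion (\<lambda>z. (1 + of_real \<alpha> * z\<^sup>2) * F z) 0
      = (1 + fps_const (of_real \<alpha>) * fps_X\<^sup>2) * fps_expansion F 0"
    by (rule fps_expansion_eqI) 
  also have "\<dots> = fps_expansion F 0 + fps_const (of_real \<alpha>) * (fps_X\<^sup>2 * fps_expansion F 0)"
    by (simp add: algebra_simps)
  finally have e: "fps_expansion (\<lambda>z. (1 + of_real \<alpha> * z\<^sup>2) * F z) 0
      = fps_expansion F 0 + fps_const (of_real \<alpha>) * (fps_X\<^sup>2 * fps_expansion F 0)" .
  show ?thesis
  proof (cases n)
    case (Suc k)
    then show ?thesis unfolding even_coeff_def e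
      by (simp add: fps_X_power_mult_nth) (simp add: algebra_simps)
  qed (simp add: even_coeff_def e fps_X_power_mult_nth)
qed

lemma even_coeff_exp:
  "even_coeff (\<lambda>z. exp (of_real b * z)) n = fact n / fact (2 * n) * (b\<^sup>2) ^ n"
proof -
  have "(\<lambda>z. exp (of_real b * z)) has_fps_expansion fps_exp (of_real b :: complex)"
    by (intro fps_expansion_intros)
  then have "fps_expansion (\<lambda>z. exp (of_real b * z)) 0 = fps_exp (of_real b :: complex)"
    by (rule fps_expansion_eqI) 
  moreover have "(of_real b :: complex) ^ (2 * n) / fact (2 * n) = of_real (b ^ (2 * n) / fact (2 * n))"
    by simp
  ultimately show ?thesis unfolding even_coeff_def
    by (simp add: power_mult del: of_real_divide of_real_power)
qed

lemma even_coeff_uniform_limit: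
  assumes lim: "uniform_limit (cball 0 1) F f sequentially"
    and F: "\<And>m. F m holomorphic_on UNIV"
  shows "(\<lambda>m. even_coeff (F m) n) \<longlonglongrightarrow> even_coeff f n"
proof -
  have "uniform_limit (ball 0 1) F f sequentially"
    by (rule uniform_limit_on_subset[OF lim]) auto
  then have "(\<lambda>m. (deriv ^^ (2 * n)) (F m) 0) \<longlonglongrightarrow> (deriv ^^ (2 * n)) f 0"
    by (rule higher_deriv_complex_uniform_limit) (auto intro!: always_eventually holomorphic_on_subset[OF F])
  then show ?thesis
    unfolding even_coeff_def fps_expansion_def fps_nth_Abs_fps by (intro tendsto_intros) auto
qed

lemma turan_seq_even_coeff_mult:
  assumes "F holomorphic_on UNIV" "turan_seq (even_coeff F)" "0 \<le> \<alpha>"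
  shows "turan_seq (even_coeff (\<lambda>z. (1 + of_real \<alpha> * z\<^sup>2) * F z))"
  using turan_seq_binomial_step[OF assms(2,3)] even_coeff_mult[OF assms(1)] by presburger

section \<open>Splitting off imaginary zeros\<close>

text \<open>
  Invariance under conjugation makes imaginary zeros occur in pairs \<open>\<plusminus> \<i> x\<close>.
\<close>

definition real_entire :: "(complex \<Rightarrow> complex) \<Rightarrow> bool" where
  "real_entire f \<longleftrightarrow> f holomorphic_on UNIV \<and> (\<forall>z. f (cnj z) = cnj (f z))"

text \<open>
  A list entry \<open>x\<close> stands for the pair of zeros \<open>\<plusminus> \<i> x\<close>; multiplicities are repetitions.
\<close>

definition zeros_prod :: "real list \<Rightarrow> complex \<Rightarrow> complex" where
  "zeros_prod xs z = (\<Prod>x\<leftarrow>xs. 1 + of_real (1 / x\<^sup>2) * z\<^sup>2)"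

definition inv_square_sum :: "real list \<Rightarrow> real" where
  "inv_square_sum xs = (\<Sum>x\<leftarrow>xs. 1 / x\<^sup>2)"

lemma zeros_prod_simps [simp]:
  "zeros_prod [] z = 1"
  "zeros_prod (x # xs) z = (1 + of_real (1 / x\<^sup>2) * z\<^sup>2) * zeros_prod xs z"
  "zeros_prod (xs @ ys) z = zeros_prod xs z * zeros_prod ys z"
  "zeros_prod xs 0 = 1"
  by (auto simp: zeros_prod_def) (induction xs, auto)

lemma inv_square_sum_simps [simp]:
  "inv_square_sum [] = 0"
  "inv_square_sum (x # xs) = 1 / x\<^sup>2 + inv_square_sum xs"
  "inv_square_sum (xs @ ys) = inv_square_sum xs + inv_square_sum ys"
  by (auto simp: inv_square_sum_def)

lemma inv_square_sum_nonneg: "0 \<le> inv_square_sum xs"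
  by (induction xs) auto

lemma holomorphic_zeros_prod [holomorphic_intros]: "zeros_prod xs holomorphic_on A"
proof -
  have "zeros_prod xs = (\<lambda>z. zeros_prod xs z)" ..
  moreover have "(\<lambda>z. zeros_prod xs z) holomorphic_on A"
    by (induction xs) (auto intro!: holomorphic_intros)
  ultimately show ?thesis by simp
qed

lemma exists_entire_quotient:
  assumes g: "g holomorphic_on UNIV" and "g a = 0"
  obtains h where "h holomorphic_on UNIV" "\<And>z. g z = (z - a) * h z"
proof
  define h where "h z = (if z = a then deriv g a else g z / (z - a))" for z
  show "h holomorphic_on UNIV"
    by (rule pole_theorem_open_0[OF g, of a]) (use assms in \<open>auto simp: h_def\<close>)
  show "g z = (z - a) * h z" for z
    using assms by (auto simp: h_def)
qed

text \<open>
  Dividing out the two zeros one after the other yields an entire quotient whose symmetry at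
  \<open>\<plusminus> \<i> x\<close> would take a separate continuity argument. Averaging the quotient with its conjugate gives a
  quotient that is symmetric everywhere.
\<close>

lemma real_entire_divide_pair:
  assumes g: "real_entire g" and z: "g (\<i> * of_real x) = 0" and x: "x > 0"
  obtains h where "real_entire h" "\<And>z. g z = (1 + of_real (1 / x\<^sup>2) * z\<^sup>2) * h z"
proof -
  from g have hg: "g holomorphic_on UNIV" and sym: "\<And>z. g (cnj z) = cnj (g z)"
    by (auto simp: real_entire_def)
  obtain h1 where h1: "h1 holomorphic_on UNIV" "\<And>z. g z = (z - \<i> * of_real x) * h1 z"
    using exists_entire_quotient[OF hg z] by blast
  have "g (- \<i> * of_real x) = 0"
    using sym[of "\<i> * of_real x"] z by simp
  then have "h1 (- \<i> * of_real x) = 0"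
    using h1(2)[of "- \<i> * of_real x"] x by (simp add: complex_eq_iff)
  then obtain h2 where h2: "h2 holomorphic_on UNIV" "\<And>z. h1 z = (z - (- \<i> * of_real x)) * h2 z"
    using exists_entire_quotient[OF h1(1)] by blast
  have g2: "g z = (1 + of_real (1 / x\<^sup>2) * z\<^sup>2) * (of_real (x\<^sup>2) * h2 z)" for z
  proof -
    have "g z = ((z - \<i> * of_real x) * (z + \<i> * of_real x)) * h2 z"
      using h1(2)[of z] h2(2)[of z] by simp
    also have "(z - \<i> * of_real x) * (z + \<i> * of_real x) = z\<^sup>2 + of_real (x\<^sup>2)"
      by (simp add: algebra_simps power2_eq_square)
    also have "\<dots> = (1 + of_real (1 / x\<^sup>2) * z\<^sup>2) * of_real (x\<^sup>2)"
      using x by (simp add: field_simps)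
    finally show ?thesis by (simp only: mult.assoc)
  qed
  define k where "k z = of_real (x\<^sup>2) * h2 z" for z
  have k: "k holomorphic_on UNIV" unfolding k_def by (intro holomorphic_intros h2(1))
  have gk: "g z = (1 + of_real (1 / x\<^sup>2) * z\<^sup>2) * k z" for z using g2 by (simp add: k_def)
  have k': "(cnj \<circ> k \<circ> cnj) holomorphic_on UNIV"
    by (rule holomorphic_on_compose_cnj_cnj) (auto intro: holomorphic_on_subset[OF k])
  have gk': "g z = (1 + of_real (1 / x\<^sup>2) * z\<^sup>2) * (cnj \<circ> k \<circ> cnj) z" for z
  proof -
    have "g z = cnj (g (cnj z))" by (simp add: sym)
    also have "\<dots> = (1 + of_real (1 / x\<^sup>2) * z\<^sup>2) * (cnj \<circ> k \<circ> cnj) z"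
      by (subst gk) simp
    finally show ?thesis .
  qed
  show ?thesis
  proof (rule that[of "\<lambda>z. (k z + (cnj \<circ> k \<circ> cnj) z) / 2"])
    show "real_entire (\<lambda>z. (k z + (cnj \<circ> k \<circ> cnj) z) / 2)"
      unfolding real_entire_def by (intro conjI holomorphic_intros k k') (auto simp: add.commute)
    show "g z = (1 + of_real (1 / x\<^sup>2) * z\<^sup>2) * ((k z + (cnj \<circ> k \<circ> cnj) z) / 2)" for z
    proof -
      have "g z = (g z + g z) / 2" by simp
      also have "\<dots> = ((1 + of_real (1 / x\<^sup>2) * z\<^sup>2) * k z
          + (1 + of_real (1 / x\<^sup>2) * z\<^sup>2) * (cnj \<circ> k \<circ> cnj) z) / 2"
        using gk[of z] gk'[of z] by argo
      also have "\<dots> = (1 + of_real (1 / x\<^sup>2) * z\<^sup>2) * ((k z + (cnj \<circ> k \<circ> cnj) z) / 2)"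
        by (simp add: distrib_left)
      finally show ?thesis .
    qed
  qed
qed

lemma norm_zeros_prod_ge:
  assumes "\<And>x. x \<in> set xs \<Longrightarrow> 0 < x \<and> x \<le> R" "norm z = 2 * R"
  shows "3 ^ length xs \<le> norm (zeros_prod xs z)"
  using assms(1)
proof (induction xs)
  case (Cons x xs)
  have x: "0 < x" "x \<le> R" using Cons.prems by auto
  have "3 \<le> (2 * R)\<^sup>2 / x\<^sup>2 - 1"
    using x power_mono[of x R 2] by (simp add: field_simps power2_eq_square)
  also have "\<dots> = norm (of_real (1 / x\<^sup>2) * z\<^sup>2) - norm (1 :: complex)"
    using assms(2) by (simp add: norm_mult norm_power norm_divide)
  also have "\<dots> \<le> norm (1 + of_real (1 / x\<^sup>2) * z\<^sup>2)"
    by (metis add.commute norm_diff_ineq)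
  finally have "3 \<le> norm (1 + of_real (1 / x\<^sup>2) * z\<^sup>2)" .
  then show ?case using Cons by (simp only: zeros_prod_simps norm_mult list.size)
      (auto intro!: mult_mono)
qed auto

text \<open>
  The maximum principle on the disc of radius \<open>2 * R\<close>: on its boundary every factor of the product has
  modulus at least \<open>3\<close>, so dividing by the product lowers the bound. The gain \<open>3 ^ length xs\<close> is what
  limits the number of zeros in \<open>extract_zeros\<close>.
\<close>

lemma norm_cofactor_le:
  assumes h: "h holomorphic_on UNIV" and gh: "\<And>z. g z = zeros_prod xs z * h z"
    and xs: "\<And>x. x \<in> set xs \<Longrightarrow> 0 < x \<and> x \<le> R" and R: "R > 0"
    and B: "\<And>z. norm z = 2 * R \<Longrightarrow> norm (g z) \<le> B" and z: "norm z \<le> 2 * R"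
  shows "norm (h z) \<le> B / 3 ^ length xs"
proof (rule maximum_modulus_frontier[of h "cball 0 (2 * R)"])
  show "h holomorphic_on interior (cball 0 (2 * R))" by (rule holomorphic_on_subset[OF h]) auto
  show "continuous_on (closure (cball 0 (2 * R))) h"
    by (intro holomorphic_on_imp_continuous_on holomorphic_on_subset[OF h]) auto
  fix w assume "w \<in> frontier (cball (0::complex) (2 * R))"
  then have w: "norm w = 2 * R" using R by (auto simp: sphere_def)
  have "3 ^ length xs * norm (h w) \<le> norm (zeros_prod xs w) * norm (h w)"
    by (intro mult_right_mono norm_zeros_prod_ge[OF xs w]) auto
  also have "\<dots> \<le> B" using B[OF w] by (simp add: gh norm_mult)
  finally show "norm (h w) \<le> B / 3 ^ length xs" by (simp add: field_simps)
qed (use z in auto)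

text \<open>
  A cofactor that vanishes somewhere in the closed disc allows one more pair of factors to be split off. As
  the cofactor has value \<open>1\<close> at the origin, the maximum principle bounds the number of pairs, so a
  factorization with the greatest number of pairs leaves no zero in the disc. This replaces any
  counting of multiplicities.
\<close>

lemma extract_zeros:
  assumes g: "real_entire g" and g0: "g 0 = 1" and imag: "\<And>z. g z = 0 \<Longrightarrow> Re z = 0" and R: "R > 0"
  obtains xs h where "\<And>x. x \<in> set xs \<Longrightarrow> 0 < x \<and> x \<le> R" "real_entire h" "h 0 = 1"
    "\<And>z. g z = zeros_prod xs z * h z" "\<And>z. norm z \<le> R \<Longrightarrow> h z \<noteq> 0"
proof -
  define Q where "Q xs h \<longleftrightarrow> (\<forall>x\<in>set xs. 0 < x \<and> x \<le> R) \<and> real_entire h \<and>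
     (\<forall>z. g z = zeros_prod xs z * h z)" for xs h
  have "compact (g ` sphere 0 (2 * R))"
    using g by (intro compact_continuous_image holomorphic_on_imp_continuous_on)
      (auto simp: real_entire_def intro: holomorphic_on_subset)
  then obtain B where B: "\<And>z. norm z = 2 * R \<Longrightarrow> norm (g z) \<le> B"
    by (force dest: compact_imp_bounded simp: bounded_iff)
  have len: "real (length xs) \<le> B" if "Q xs h" for xs h
  proof -
    have "g 0 = zeros_prod xs 0 * h 0" using that by (simp add: Q_def del: zeros_prod_simps)
    then have "h 0 = 1" using g0 by simp
    moreover have "norm (h 0) \<le> B / 3 ^ length xs"
      by (rule norm_cofactor_le[of h g xs R]) (use that R B in \<open>auto simp: Q_def real_entire_def\<close>)
    ultimately have "3 ^ length xs \<le> B" by (simp add: field_simps)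
    moreover have "real (length xs) \<le> 3 ^ length xs" 
      using of_nat_less_two_power[of "length xs", where ?'a = real] power_mono[of 2 "3::real" "length xs"] by simp
    ultimately show ?thesis by linarith
  qed
  define P where "P n \<longleftrightarrow> (\<exists>xs h. length xs = n \<and> Q xs h)" for n
  have "P 0" unfolding P_def Q_def using g by (intro exI[of _ "[]"] exI[of _ g]) auto
  moreover have "\<forall>n. P n \<longrightarrow> n \<le> nat \<lfloor>B\<rfloor>"
    unfolding P_def using len by (auto simp: le_nat_floor)
  ultimately obtain n where n: "P n" "\<And>k. P k \<Longrightarrow> k \<le> n"
    by (metis Nat.ex_has_greatest_nat)
  then obtain xs h where xs: "length xs = n" "Q xs h" by (auto simp: P_def)
  have gh: "g z = zeros_prod xs z * h z" for z using xs by (auto simp: Q_def)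
  have h0: "h 0 = 1" using gh[of 0] g0 by simp
  have "h z \<noteq> 0" if z: "norm z \<le> R" for z
  proof
    assume hz: "h z = 0"
    then have "Re z = 0" using gh[of z] imag by simp
    then have zi: "z = \<i> * of_real (Im z)" by (simp add: complex_eq_iff)
    define y where "y = \<bar>Im z\<bar>"
    have "z \<noteq> 0" using hz h0 by auto
    then have y: "0 < y" "y \<le> R" using \<open>Re z = 0\<close> z abs_Im_le_cmod[of z] 
      by (auto simp: y_def complex_eq_iff)
    have "\<i> * of_real y = z \<or> \<i> * of_real y = cnj z"
      using \<open>Re z = 0\<close> by (auto simp: y_def complex_eq_iff)
    moreover have "h (cnj z) = 0" using xs(2) hz by (simp add: Q_def real_entire_def)
    ultimately have "h (\<i> * of_real y) = 0" using hz by auto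
    then obtain k where k: "real_entire k" "\<And>z. h z = (1 + of_real (1 / y\<^sup>2) * z\<^sup>2) * k z"
      using real_entire_divide_pair[of h y] xs(2) y by (auto simp: Q_def)
    have "Q (y # xs) k"
      using xs(2) y k by (auto simp: Q_def)
    then have "P (Suc n)" unfolding P_def using xs(1) by (intro exI[of _ "y # xs"]) auto
    then show False using n(2) by fastforce
  qed
  then show ?thesis using that[of xs h] xs(2) h0 by (auto simp: Q_def)
qed

text \<open>
  The lists for growing discs extend one another, which is what makes the sums of \<open>1 / x\<^sup>2\<close> monotone and
  lets a fixed initial product control all later ones.
\<close>

lemma exhaust_zeros:
  assumes f: "real_entire f" and f0: "f 0 = 1" and imag: "\<And>z. f z = 0 \<Longrightarrow> Re z = 0"
  obtains xs h where
    "\<And>m x. x \<in> set (xs m) \<Longrightarrow> 0 < x \<and> x \<le> real m"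
    "\<And>m. \<exists>ys. xs (Suc m) = xs m @ ys"
    "\<And>m. h m holomorphic_on UNIV" "\<And>m z. f z = zeros_prod (xs m) z * h m z"
    "\<And>m z. norm z < real m \<Longrightarrow> h m z \<noteq> 0"
proof -
  define P where "P m p \<longleftrightarrow> (\<forall>x\<in>set (fst p). 0 < x \<and> x \<le> real m) \<and> real_entire (snd p) \<and>
     snd p 0 = 1 \<and> (\<forall>z. f z = zeros_prod (fst p) z * snd p z) \<and>
     (\<forall>z. norm z < real m \<longrightarrow> snd p z \<noteq> 0)" for m and p :: "real list \<times> (complex \<Rightarrow> complex)"
  have "\<exists>p. \<forall>m. P m (p m) \<and> (\<exists>ys. fst (p (Suc m)) = fst (p m) @ ys)"
  proof (rule dependent_nat_choice)
    show "\<exists>p. P 0 p" using f f0 by (intro exI[of _ "([], f)"]) (auto simp: P_def)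
  next
    fix p m assume p: "P m p"
    have imag': "Re z = 0" if "snd p z = 0" for z
      using that p imag[of z] by (simp add: P_def)
    obtain ys h where yh: "\<And>x. x \<in> set ys \<Longrightarrow> 0 < x \<and> x \<le> real (Suc m)" "real_entire h" "h 0 = 1"
      "\<And>z. snd p z = zeros_prod ys z * h z" "\<And>z. norm z \<le> real (Suc m) \<Longrightarrow> h z \<noteq> 0"
      using extract_zeros[of "snd p" "real (Suc m)"] p imag' by (auto simp: P_def)
    have "P (Suc m) (fst p @ ys, h)"
      using p yh by (force simp: P_def mult.assoc)
    then show "\<exists>q. P (Suc m) q \<and> (\<exists>ys. fst q = fst p @ ys)" by force
  qed
  then obtain p where p: "\<And>m. P m (p m)" "\<And>m. \<exists>ys. fst (p (Suc m)) = fst (p m) @ ys" by blast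
  show ?thesis
    by (rule that[of "\<lambda>m. fst (p m)" "\<lambda>m. snd (p m)"])
       (use p in \<open>auto simp: P_def real_entire_def\<close>)
qed

section \<open>Factorization of functions with imaginary zeros\<close>

text \<open>
  A form of the Borel--Caratheodory inequality. The bound says \<open>Re q < M\<close>; the map
  \<open>u \<mapsto> u / (2 M - u)\<close> takes this half-plane into the unit disc and fixes \<open>0\<close>, so the Schwarz lemma
  applies to its composition with \<open>q\<close>.
\<close>

lemma zero_free_logarithm_bound:
  assumes h: "h holomorphic_on UNIV" and h0: "h 0 = 1" and R: "R > 0"
    and nz: "\<And>z. norm z < R \<Longrightarrow> h z \<noteq> 0"
    and bd: "\<And>z. norm z < R \<Longrightarrow> norm (h z) < exp M"
  obtains q where "q holomorphic_on ball 0 R" "q 0 = 0" "\<And>z. norm z < R \<Longrightarrow> h z = exp (q z)"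
    "\<And>z. norm z \<le> R / 2 \<Longrightarrow> norm (q z) \<le> 2 * M"
proof -
  obtain q1 where q1: "q1 holomorphic_on ball 0 R" "\<And>z. z \<in> ball 0 R \<Longrightarrow> exp (q1 z) = h z"
  proof (rule holomorphic_logarithm_exists[of "ball 0 R" h 0])
    show "h holomorphic_on ball 0 R" by (rule holomorphic_on_subset[OF h]) simp
  qed (use R nz in auto)
  define q where "q z = q1 z - q1 0" for z
  have q: "q holomorphic_on ball 0 R" unfolding q_def by (intro holomorphic_intros q1)
  have hq: "h z = exp (q z)" if "norm z < R" for z
    using q1(2)[of z] q1(2)[of 0] R h0 that by (simp add: q_def exp_diff)
  have M: "M > 0" using bd[of 0] R h0 by simp
  have Re_q: "Re (q z) < M" if "norm z < R" for z
    using bd[OF that] hq[OF that] by simp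
  define \<phi> where "\<phi> w = q (of_real R * w) / (2 * of_real M - q (of_real R * w))" for w
  have denom: "norm (q z) < norm (2 * of_real M - q z)" if "norm z < R" for z
  proof -
    have "(norm (2 * of_real M - q z))\<^sup>2 - (norm (q z))\<^sup>2 = 4 * M * (M - Re (q z))"
      unfolding cmod_power2 by (simp add: power2_eq_square algebra_simps)
    also have "\<dots> > 0" using M Re_q[OF that] by simp
    finally have "(norm (q z))\<^sup>2 < (norm (2 * of_real M - q z))\<^sup>2" by simp
    then show ?thesis by (rule power2_less_imp_less) simp
  qed
  have scale: "norm (of_real R * w) < R" if "norm w < 1" for w :: complex
    using that R by (simp add: norm_mult)
  have \<phi>_holo: "\<phi> holomorphic_on ball 0 1" unfolding \<phi>_def
  proof (intro holomorphic_intros)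
    have "(q \<circ> (\<lambda>w. of_real R * w)) holomorphic_on ball 0 1"
    proof (rule holomorphic_on_compose_gen[OF _ q])
      show "(\<lambda>w. of_real R * w) ` ball 0 1 \<subseteq> ball (0 :: complex) R"
        using scale by (simp add: image_subset_iff)
    qed (intro holomorphic_intros)
    then show "(\<lambda>w. q (of_real R * w)) holomorphic_on ball 0 1" unfolding o_def .
    then show "(\<lambda>w. q (of_real R * w)) holomorphic_on ball 0 1" .
    fix w :: complex assume "w \<in> ball 0 1"
    then show "2 * of_real M - q (of_real R * w) \<noteq> 0"
      using denom[OF scale[of w]] by auto
  qed
  have \<phi>_lt: "norm (\<phi> w) < 1" if "norm w < 1" for w
    using denom[OF scale[OF that]] by (simp add: \<phi>_def norm_divide divide_less_eq_1)
  have bound: "norm (q z) \<le> 2 * M" if z: "norm z \<le> R / 2" for z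
  proof -
    define w where "w = z / of_real R"
    have zw: "z = of_real R * w" using R by (simp add: w_def)
    have w: "norm w \<le> 1 / 2" using z R by (simp add: w_def norm_divide field_simps)
    have zR: "norm z < R" using z R by linarith
    have "norm (\<phi> w) \<le> norm w"
      by (rule Schwarz_Lemma(1)[OF \<phi>_holo _ \<phi>_lt]) (use w in \<open>auto simp: \<phi>_def q_def\<close>)
    then have "norm (\<phi> w) \<le> 1 / 2" using w by linarith
    then have "norm (q z) \<le> 1 / 2 * norm (2 * of_real M - q z)"
      using denom[OF zR] by (simp add: \<phi>_def zw norm_divide divide_le_eq split: if_splits)
    also have "norm (2 * of_real M - q z) \<le> 2 * M + norm (q z)"
      using norm_triangle_ineq4[of "2 * of_real M" "q z"] M by simp
    finally show ?thesis by simp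
  qed
  show ?thesis by (rule that[OF q _ hq bound]) (auto simp: q_def)
qed


lemma higher_deriv_bound_of_half_disc:
  assumes q: "q holomorphic_on ball 0 R" and R: "R > 0" and B: "B > 0"
    and bd: "\<And>z. norm z \<le> R / 2 \<Longrightarrow> norm (q z) \<le> B"
    and n: "n > 0" and w: "norm w \<le> R / 4"
  shows "norm ((deriv ^^ n) q w) \<le> fact n * (2 * B) / (R / 4) ^ n"
  \<comment> \<open>Cauchy's estimate on the disc of radius \<open>R / 4\<close> about \<open>w\<close>. It asks for values in an open
    ball; the factor \<open>2\<close> makes the inclusion strict.\<close>
proof (rule Cauchy_higher_deriv_bound[where y = 0])
  have sub: "norm u \<le> R / 2" if "norm (u - w) \<le> R / 4" for u
    using norm_triangle_ineq2[of u w] that w by linarith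
  have cb: "cball w (R / 4) \<subseteq> ball 0 R"
    using sub R by (force simp: dist_norm norm_minus_commute)
  show "q holomorphic_on ball w (R / 4)" by (rule holomorphic_on_subset[OF q]) (use cb in auto)
  show "continuous_on (cball w (R / 4)) q"
    by (intro holomorphic_on_imp_continuous_on holomorphic_on_subset[OF q] cb)
  show "q u \<in> ball 0 (2 * B)" if "u \<in> ball w (R / 4)" for u
    using bd[OF sub[of u]] that B by (simp add: dist_norm norm_minus_commute)
qed (use R n in auto)

text \<open>
  Taylor's formula with the third derivative bounded on the disc of radius \<open>R / 4\<close>; the constant is
  \<open>3! \<cdot> 2 \<cdot> 4\<^sup>3 / 2!\<close>.
\<close>

lemma quadratic_taylor_bound:
  assumes q: "q holomorphic_on ball 0 R" and q0: "q 0 = 0" and R: "R > 0" and B: "B > 0"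
    and bd: "\<And>z. norm z \<le> R / 2 \<Longrightarrow> norm (q z) \<le> B" and z: "norm z \<le> R / 4"
  shows "norm (q z - (deriv q 0 * z + (deriv ^^ 2) q 0 / 2 * z\<^sup>2)) \<le> 384 * B * norm z ^ 3 / R ^ 3"
proof -
  have "norm ((deriv ^^ 0) q z - (\<Sum>i\<le>2. (deriv ^^ i) q 0 * (z - 0) ^ i / fact i))
      \<le> (fact 3 * (2 * B) / (R / 4) ^ 3) * norm (z - 0) ^ Suc 2 / fact 2"
  proof (rule complex_Taylor[of "cball 0 (R / 4)"])
    fix i x assume x: "x \<in> cball (0::complex) (R / 4)"
    show "((deriv ^^ i) q has_field_derivative (deriv ^^ Suc i) q x) (at x within cball 0 (R / 4))"
      using has_field_derivative_higher_deriv[OF q, of x i] x R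
      by (auto intro: has_field_derivative_at_within)
    show "norm ((deriv ^^ Suc 2) q x) \<le> fact 3 * (2 * B) / (R / 4) ^ 3"
      using higher_deriv_bound_of_half_disc[OF q R B bd, of 3 x] x by (simp add: eval_nat_numeral)
  qed (use z R in auto)
  then show ?thesis using q0
    by (simp add: eval_nat_numeral field_simps)
qed

lemma zeros_prod_derivs:
  "deriv (zeros_prod xs) 0 = 0" "(deriv ^^ 2) (zeros_prod xs) 0 = of_real (2 * inv_square_sum xs)"
proof (induction xs)
  case Nil
  have e: "zeros_prod [] = (\<lambda>z. 1)" by auto
  case 1 show ?case by (simp add: e)
  case 2 show ?case by (simp add: e eval_nat_numeral)
next
  case (Cons x xs)
  define c :: complex where "c = of_real (1 / x\<^sup>2)"
  define l where "l z = 1 + c * z\<^sup>2" for z :: complex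
  have l: "l holomorphic_on UNIV" unfolding l_def by (intro holomorphic_intros)
  have e: "zeros_prod (x # xs) = (\<lambda>z. l z * zeros_prod xs z)" by (auto simp: l_def c_def)
  have dl: "deriv l = (\<lambda>z. c * (2 * z))"
    unfolding l_def by (rule ext, rule DERIV_imp_deriv) (auto intro!: derivative_eq_intros)
  have ddl: "deriv (deriv l) = (\<lambda>z. c * 2)"
    unfolding dl by (rule ext, rule DERIV_imp_deriv) (auto intro!: derivative_eq_intros)
  note hm = higher_deriv_mult[OF l holomorphic_zeros_prod open_UNIV UNIV_I, of _ xs 0]
  case 1 show ?case using hm[of 1] Cons by (simp add: e dl)
  case 2 show ?case using hm[of 2] Cons
    by (simp add: e dl ddl eval_nat_numeral) (simp add: l_def c_def algebra_simps power2_eq_square)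
qed

text \<open>
  Near the origin \<open>zeros_prod xs z = 1 + s z\<^sup>2 + \<dots>\<close> with \<open>s = inv_square_sum xs\<close>. Hence the linear
  coefficient of \<open>q\<close> is that of \<open>f\<close>, and the quadratic one is a number determined by
  \<open>f\<close> alone, minus \<open>s\<close>.
\<close>

lemma derivs_of_prod_exp:
  assumes f: "\<And>z. norm z < R \<Longrightarrow> f z = zeros_prod xs z * exp (q z)" and R: "R > 0"
    and q: "q holomorphic_on ball 0 R" and q0: "q 0 = 0"
  shows "deriv q 0 = deriv f 0"
    "(deriv ^^ 2) q 0 = (deriv ^^ 2) f 0 - (deriv f 0)\<^sup>2 - of_real (2 * inv_square_sum xs)"
proof -
  have e: "(\<lambda>z. exp (q z)) holomorphic_on ball 0 R" by (intro holomorphic_intros q)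
  have near: "\<forall>\<^sub>F z in nhds 0. z \<in> ball (0::complex) R"
    using R by (intro eventually_nhds_in_open) auto
  then have ev: "\<forall>\<^sub>F z in nhds 0. f z = zeros_prod xs z * exp (q z)"
    by eventually_elim (use f in auto)
  have dq: "(q has_field_derivative deriv q z) (at z)" if "z \<in> ball 0 R" for z
    using holomorphic_derivI[OF q _ that] by auto
  have de: "deriv (\<lambda>z. exp (q z)) z = deriv q z * exp (q z)" if "z \<in> ball 0 R" for z
    by (rule DERIV_imp_deriv) (use dq[OF that] in \<open>auto intro!: derivative_eq_intros\<close>)
  have dq': "deriv q holomorphic_on ball 0 R" by (intro holomorphic_deriv q) auto
  have ddq: "(deriv q has_field_derivative deriv (deriv q) 0) (at 0)"
    using holomorphic_derivI[OF dq' _, of 0] R by auto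
  have "deriv (deriv (\<lambda>z. exp (q z))) 0 = deriv (\<lambda>z. deriv q z * exp (q z)) 0"
    by (intro deriv_cong_ev)
      (use near in \<open>auto elim!: eventually_mono simp: de\<close>)
  also have "\<dots> = deriv (deriv q) 0 * exp (q 0) + deriv q 0 * (deriv q 0 * exp (q 0))"
    by (rule DERIV_imp_deriv) (use ddq dq[of 0] R in \<open>auto intro!: derivative_eq_intros\<close>)
  finally have dde: "deriv (deriv (\<lambda>z. exp (q z))) 0 = deriv (deriv q) 0 + (deriv q 0)\<^sup>2"
    by (simp add: q0 power2_eq_square)
  have fd: "(deriv ^^ n) f 0 = (\<Sum>i = 0..n. of_nat (n choose i) * (deriv ^^ i) (zeros_prod xs) 0 *
      (deriv ^^ (n - i)) (\<lambda>z. exp (q z)) 0)" for n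
    unfolding higher_deriv_cong_ev[OF ev refl]
    by (rule higher_deriv_mult[OF _ e]) (use R in \<open>auto intro!: holomorphic_intros\<close>)
  show 1: "deriv q 0 = deriv f 0"
    using fd[of 1] R by (simp add: zeros_prod_derivs de q0)
  show "(deriv ^^ 2) q 0 = (deriv ^^ 2) f 0 - (deriv f 0)\<^sup>2 - of_real (2 * inv_square_sum xs)"
    using fd[of 2] zeros_prod_derivs(2)[of xs] R
    by (simp add: eval_nat_numeral zeros_prod_derivs(1) de dde q0 1[symmetric])
qed

lemma real_entire_deriv:
  assumes "real_entire f" shows "real_entire (deriv f)"
proof -
  have f: "f holomorphic_on UNIV" and sym: "\<And>z. f (cnj z) = cnj (f z)"
    using assms by (auto simp: real_entire_def)
  have e: "cnj \<circ> f \<circ> cnj = f" using sym by (auto simp: fun_eq_iff) 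
  have "deriv f (cnj z) = cnj (deriv f z)" for z
  proof -
    have "(f has_field_derivative deriv f (cnj z)) (at (cnj z))"
      using holomorphic_derivI[OF f] by auto
    then have "(f has_field_derivative cnj (deriv f (cnj z))) (at z)"
      using has_field_derivative_cnj_cnj[of f "deriv f (cnj z)" z] e by simp
    then have "deriv f z = cnj (deriv f (cnj z))" by (rule DERIV_imp_deriv)
    then show ?thesis by simp
  qed
  then show ?thesis using holomorphic_deriv[OF f] by (simp add: real_entire_def)
qed

lemma real_entire_at_0: "real_entire f \<Longrightarrow> f 0 = of_real (Re (f 0))"
  unfolding real_entire_def by (metis complex_cnj_zero Reals_cnj_iff complex_is_Real_iff of_real_Re)

lemma prefix_chain:
  assumes "\<And>m. \<exists>ys. xs (Suc m) = xs m @ ys" "N \<le> m"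
  obtains ys where "xs m = xs N @ ys"
proof -
  have "\<exists>ys. xs m = xs N @ ys" using assms(2)
    by (induction m rule: dec_induct) (use assms(1) in \<open>simp, metis append.assoc\<close>)
  then show ?thesis using that by blast
qed

definition gaussian_growth :: "(complex \<Rightarrow> complex) \<Rightarrow> bool" where
  "gaussian_growth f \<longleftrightarrow> (\<exists>C C'. \<forall>z. norm (f z) \<le> C * exp (C' * (norm z)\<^sup>2))"

text \<open>
  The case of Hadamard's theorem that matters here. On the disc of radius \<open>m\<close> the logarithm \<open>q m\<close> of the
  zero-free factor is \<open>O(m\<^sup>2)\<close>, so its Taylor coefficients of order \<open>k\<close> are \<open>O(m\<^sup>2\<^sup>-\<^sup>k)\<close>: those of
  order at least three vanish in the limit. The coefficient of order two stays bounded. By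
  \<open>derivs_of_prod_exp\<close> it equals a constant minus the increasing sum of the \<open>1 / x\<^sup>2\<close>, and therefore both
  converge.
\<close>

theorem imaginary_zeros_factorization:
  assumes f: "real_entire f" and f0: "f 0 = 1" and imag: "\<And>z. f z = 0 \<Longrightarrow> Re z = 0"
    and growth: "gaussian_growth f"
  obtains xs :: "nat \<Rightarrow> real list" and q and S a b :: real where
    "\<And>m. \<exists>ys. xs (Suc m) = xs m @ ys"
    "(\<lambda>m. inv_square_sum (xs m)) \<longlonglongrightarrow> S"
    "\<And>m z. norm z < real m \<Longrightarrow> f z = zeros_prod (xs m) z * exp (q m z)"
    "\<And>r. uniform_limit (cball 0 r) q (\<lambda>z. of_real b * z + of_real a * z\<^sup>2) sequentially"
proof -
  obtain xs h where
    xs: "\<And>m x. x \<in> set (xs m) \<Longrightarrow> 0 < x \<and> x \<le> real m" 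
    and chain: "\<And>m. \<exists>ys. xs (Suc m) = xs m @ ys"
    and h: "\<And>m. h m holomorphic_on UNIV" and fh: "\<And>m z. f z = zeros_prod (xs m) z * h m z"
    and nz: "\<And>m z. norm z < real m \<Longrightarrow> h m z \<noteq> 0"
    using exhaust_zeros[OF f f0 imag] by metis
  obtain C C' where C: "\<And>z. norm (f z) \<le> C * exp (C' * (norm z)\<^sup>2)"
    using growth by (auto simp: gaussian_growth_def)
  have C1: "C \<ge> 1" using C[of 0] f0 by simp
  \<comment> \<open>Chosen so that \<open>C * exp (C' * (2 * m)\<^sup>2) < exp (K * m\<^sup>2)\<close> for all \<open>m \<ge> 1\<close>.\<close>
  define K where "K = 4 * \<bar>C'\<bar> + ln C + 1"
  have lnC: "ln C \<ge> 0" using C1 by simp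
  have K: "K > 0" using lnC by (simp add: K_def add_nonneg_pos)
  have h0: "h m 0 = 1" for m using fh[of 0 m] f0 by simp
  have hbd: "norm (h m z) < exp (K * (real m)\<^sup>2)" if m: "m > 0" and z: "norm z < real m" for m z
  proof -
    have "norm (h m z) \<le> C * exp (C' * (2 * real m)\<^sup>2) / 3 ^ length (xs m)"
    proof (rule norm_cofactor_le[of "h m" f "xs m" "real m", OF h fh xs])
      show "norm (f w) \<le> C * exp (C' * (2 * real m)\<^sup>2)" if "norm w = 2 * real m" for w
        using C[of w] that by simp
    qed (use m z in auto)
    also have "\<dots> \<le> C * exp (C' * (2 * real m)\<^sup>2)"
      using C1 by (simp add: divide_le_eq_1 field_simps)
    also have "\<dots> = exp (ln C + 4 * C' * (real m)\<^sup>2)"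
      using C1 by (simp add: exp_add power_mult_distrib)
    also have "\<dots> < exp (K * (real m)\<^sup>2)"
    proof -
      have m1: "1 \<le> (real m)\<^sup>2" using m by simp
      have "ln C * 1 \<le> ln C * (real m)\<^sup>2" using lnC m1 by (intro mult_left_mono)
      moreover have "C' * (real m)\<^sup>2 \<le> \<bar>C'\<bar> * (real m)\<^sup>2" by (intro mult_right_mono) auto
      ultimately show ?thesis using m1 by (simp add: K_def algebra_simps)
    qed
    finally show ?thesis .
  qed
  have "\<exists>q. \<forall>m>0. q m holomorphic_on ball 0 (real m) \<and> q m 0 = 0 \<and>
      (\<forall>z. norm z < real m \<longrightarrow> h m z = exp (q m z)) \<and>
      (\<forall>z. norm z \<le> real m / 2 \<longrightarrow> norm (q m z) \<le> 2 * (K * (real m)\<^sup>2))"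
  proof (intro choice allI)
    fix m show "\<exists>q. m > 0 \<longrightarrow> q holomorphic_on ball 0 (real m) \<and> q 0 = 0 \<and>
      (\<forall>z. norm z < real m \<longrightarrow> h m z = exp (q z)) \<and>
      (\<forall>z. norm z \<le> real m / 2 \<longrightarrow> norm (q z) \<le> 2 * (K * (real m)\<^sup>2))"
    proof (cases "m > 0")
      case True
      then show ?thesis
        using zero_free_logarithm_bound[OF h h0 _ nz hbd, of m] by (metis of_nat_0_less_iff)
    qed auto
  qed
  then obtain q where q: "\<And>m. m > 0 \<Longrightarrow> q m holomorphic_on ball 0 (real m)"
    and q0: "\<And>m. m > 0 \<Longrightarrow> q m 0 = 0"
    and hq: "\<And>m z. m > 0 \<Longrightarrow> norm z < real m \<Longrightarrow> h m z = exp (q m z)"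
    and qbd: "\<And>m z. m > 0 \<Longrightarrow> norm z \<le> real m / 2 \<Longrightarrow> norm (q m z) \<le> 2 * (K * (real m)\<^sup>2)"
    by blast
  have fq: "f z = zeros_prod (xs m) z * exp (q m z)" if "norm z < real m" for m z
  proof -
    have "m > 0" using that by (cases m) auto
    then show ?thesis using fh[of z m] hq[of m z] that by simp
  qed
  define b where "b = Re (deriv f 0)"
  define c where "c = Re (deriv (deriv f) 0)"
  define s where "s m = inv_square_sum (xs m)" for m
  have b: "deriv f 0 = of_real b"
    unfolding b_def by (intro real_entire_at_0 real_entire_deriv f)
  have c: "(deriv ^^ 2) f 0 = of_real c"
    unfolding c_def eval_nat_numeral by simp (intro real_entire_at_0 real_entire_deriv f)
  have dq: "deriv (q m) 0 = of_real b" 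
    "(deriv ^^ 2) (q m) 0 = of_real (c - b\<^sup>2 - 2 * s m)" if "m > 0" for m
    using derivs_of_prod_exp[of "real m" f "xs m" "q m"] fq that q q0 b c by (auto simp: s_def)
  have s_bound: "s m \<le> \<bar>c - b\<^sup>2\<bar> + 64 * K" for m
  proof (cases "m > 0")
    case True
    have "norm ((deriv ^^ 2) (q m) 0) \<le> fact 2 * (2 * (2 * (K * (real m)\<^sup>2))) / (real m / 4) ^ 2"
      by (rule higher_deriv_bound_of_half_disc[OF q _ _ qbd]) (use True K in auto)
    also have "\<dots> = 128 * K" using True by (simp add: field_simps power2_eq_square)
    finally show ?thesis unfolding dq(2)[OF True] norm_of_real by (simp add: abs_if split: if_splits)
  next
    case False
    then have "xs m = []" using xs[of _ m] by (cases "xs m") force+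
    then show ?thesis using K by (simp add: s_def)
  qed
  have "incseq s"
  proof (rule incseq_SucI)
    fix m obtain ys where "xs (Suc m) = xs m @ ys" using chain by blast
    then show "s m \<le> s (Suc m)" using inv_square_sum_nonneg[of ys] by (simp add: s_def)
  qed
  then obtain S where S: "s \<longlonglongrightarrow> S"
    using incseq_convergent[of s] s_bound by metis
  define a where "a = (c - b\<^sup>2) / 2 - S"
  have ulim: "uniform_limit (cball 0 r) q (\<lambda>z. of_real b * z + of_real a * z\<^sup>2) sequentially" for r
  proof (rule uniform_limitI)
    fix e :: real assume e: "e > 0"
    have "(\<lambda>m. 768 * K * \<bar>r\<bar> ^ 3 / real m + \<bar>s m - S\<bar> * \<bar>r\<bar>\<^sup>2) \<longlonglongrightarrow> 0 + \<bar>S - S\<bar> * \<bar>r\<bar>\<^sup>2"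
      by (intro tendsto_intros S lim_const_over_n)
    then have "\<forall>\<^sub>F m in sequentially. 768 * K * \<bar>r\<bar> ^ 3 / real m + \<bar>s m - S\<bar> * \<bar>r\<bar>\<^sup>2 < e"
      using e by (auto dest: order_tendstoD)
    moreover have "\<forall>\<^sub>F m in sequentially. real m \<ge> 4 * \<bar>r\<bar> + 1"
      using filterlim_real_sequentially by (simp add: filterlim_at_top)
    ultimately show "\<forall>\<^sub>F m in sequentially. \<forall>z\<in>cball 0 r. dist (q m z) (of_real b * z + of_real a * z\<^sup>2) < e"
    proof eventually_elim
      case (elim m)
      show ?case
      proof
        fix z assume "z \<in> cball (0::complex) r"
        then have z: "norm z \<le> \<bar>r\<bar>" by simp
        have m: "m > 0" using elim(2) by (cases m) auto
        have "norm (q m z - (deriv (q m) 0 * z + (deriv ^^ 2) (q m) 0 / 2 * z\<^sup>2))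
            \<le> 384 * (2 * (K * (real m)\<^sup>2)) * norm z ^ 3 / real m ^ 3"
          by (rule quadratic_taylor_bound[OF q q0 _ _ qbd]) (use m K z elim(2) in auto)
        also have "\<dots> = 768 * K * norm z ^ 3 / real m"
          using m by (simp add: field_simps eval_nat_numeral)
        also have "\<dots> \<le> 768 * K * \<bar>r\<bar> ^ 3 / real m"
          using z K by (intro divide_right_mono mult_left_mono power_mono) auto
        finally have 1: "norm (q m z - (of_real b * z + of_real (c - b\<^sup>2 - 2 * s m) / 2 * z\<^sup>2))
            \<le> 768 * K * \<bar>r\<bar> ^ 3 / real m"
          unfolding dq[OF m] .
        have "(of_real b * z + of_real (c - b\<^sup>2 - 2 * s m) / 2 * z\<^sup>2) - (of_real b * z + of_real a * z\<^sup>2)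
            = of_real (S - s m) * z\<^sup>2"
          by (simp add: a_def field_simps)
        then have "norm ((of_real b * z + of_real (c - b\<^sup>2 - 2 * s m) / 2 * z\<^sup>2) - (of_real b * z + of_real a * z\<^sup>2))
            = \<bar>s m - S\<bar> * (norm z)\<^sup>2"
          by (simp only: norm_mult norm_of_real norm_power) (simp add: abs_minus_commute)
        also have "\<dots> \<le> \<bar>s m - S\<bar> * \<bar>r\<bar>\<^sup>2"
          using z by (intro mult_left_mono power_mono) auto
        finally have 2: "norm ((of_real b * z + of_real (c - b\<^sup>2 - 2 * s m) / 2 * z\<^sup>2)
            - (of_real b * z + of_real a * z\<^sup>2)) \<le> \<bar>s m - S\<bar> * \<bar>r\<bar>\<^sup>2" .
        show "dist (q m z) (of_real b * z + of_real a * z\<^sup>2) < e"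
          using 1 2 elim(1) dist_triangle[of "q m z" "of_real b * z + of_real a * z\<^sup>2"
              "of_real b * z + of_real (c - b\<^sup>2 - 2 * s m) / 2 * z\<^sup>2"]
          unfolding dist_norm by linarith
      qed
    qed
  qed
  show ?thesis
    by (rule that[OF chain _ fq ulim]) (use S in \<open>auto simp: s_def[abs_def]\<close>)
qed

section \<open>The sign of the quadratic exponent\<close>

lemma norm_zeros_prod_real_le:
  "norm (zeros_prod xs (of_real x)) \<le> exp (x\<^sup>2 * inv_square_sum xs)"
proof (induction xs)
  case (Cons y xs)
  have "norm (1 + of_real (1 / y\<^sup>2) * (of_real x)\<^sup>2 :: complex) = norm (of_real (1 + x\<^sup>2 / y\<^sup>2) :: complex)"
    by (rule arg_cong[where f = norm]) simp
  also have "\<dots> = 1 + x\<^sup>2 / y\<^sup>2" unfolding norm_of_real by simp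
  also have "\<dots> \<le> exp (x\<^sup>2 / y\<^sup>2)" by (rule exp_ge_add_one_self)
  finally show ?case using Cons
    by (simp only: zeros_prod_simps norm_mult inv_square_sum_simps distrib_left exp_add)
      (auto intro!: mult_mono)
qed auto

lemma zeros_prod_gaussian_decay:
  assumes "\<epsilon> > 0"
  shows "((\<lambda>x::real. norm (zeros_prod xs (of_real x)) * exp (\<beta> * x - \<epsilon> * x\<^sup>2)) \<longlongrightarrow> 0) at_top"
  using assms
proof (induction xs arbitrary: \<epsilon>)
  case Nil
  have "((\<lambda>x::real. exp (\<beta> * x - \<epsilon> * x\<^sup>2)) \<longlongrightarrow> 0) at_top" using Nil by real_asymp
  then show ?case by simp
next
  case (Cons y xs)
  define c where "c = 1 / y\<^sup>2"
  have c: "c \<ge> 0" by (simp add: c_def)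
  have e: "\<epsilon> / 2 > 0" using Cons.prems by simp
  have "((\<lambda>x::real. (1 + c * x\<^sup>2) * exp (- (\<epsilon> / 2 * x\<^sup>2))) \<longlongrightarrow> 0) at_top"
  proof (cases "c = 0")
    case True
    then show ?thesis using e by simp real_asymp
  next
    case False
    with c have "c > 0" by simp
    then show ?thesis using e by real_asymp
  qed
  from tendsto_mult[OF this Cons.IH[OF e]] show ?case
  proof (rule filterlim_cong[THEN iffD1, rotated 3])
    show "\<forall>\<^sub>F x in at_top. (1 + c * x\<^sup>2) * exp (- (\<epsilon> / 2 * x\<^sup>2)) *
        (norm (zeros_prod xs (of_real x)) * exp (\<beta> * x - \<epsilon> / 2 * x\<^sup>2))
      = norm (zeros_prod (y # xs) (of_real x)) * exp (\<beta> * x - \<epsilon> * x\<^sup>2)"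
    proof (intro always_eventually allI)
      fix x :: real
      have "norm (1 + of_real (1 / y\<^sup>2) * (of_real x)\<^sup>2 :: complex) = norm (of_real (1 + c * x\<^sup>2) :: complex)"
        by (rule arg_cong[where f = norm]) (simp add: c_def)
      also have "\<dots> = 1 + c * x\<^sup>2" unfolding norm_of_real using c by simp
      finally have 1: "norm (1 + of_real (1 / y\<^sup>2) * (of_real x)\<^sup>2 :: complex) = 1 + c * x\<^sup>2" .
      have 2: "exp (\<beta> * x - \<epsilon> * x\<^sup>2) = exp (- (\<epsilon> / 2 * x\<^sup>2)) * exp (\<beta> * x - \<epsilon> / 2 * x\<^sup>2)"
        unfolding exp_add[symmetric] by (simp add: algebra_simps)
      show "(1 + c * x\<^sup>2) * exp (- (\<epsilon> / 2 * x\<^sup>2)) *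
        (norm (zeros_prod xs (of_real x)) * exp (\<beta> * x - \<epsilon> / 2 * x\<^sup>2))
      = norm (zeros_prod (y # xs) (of_real x)) * exp (\<beta> * x - \<epsilon> * x\<^sup>2)"
        unfolding zeros_prod_simps norm_mult 1 2 by (simp only: mult_ac)
    qed
  qed auto
qed

text \<open>
  If \<open>a < 0\<close>, fix \<open>N\<close> such that the zeros beyond the list \<open>xs N\<close> contribute less than \<open>- a / 2\<close> to the sum
  of the \<open>1 / x\<^sup>2\<close>. By \<open>1 + u \<le> exp u\<close> the product over these zeros is at most \<open>exp (- a / 2 * x\<^sup>2)\<close>
  on the real line, so half of the decay of \<open>exp (a * x\<^sup>2)\<close> remains, and it beats the polynomial
  \<open>zeros_prod (xs N)\<close>.
\<close>

lemma quadratic_exponent_nonneg: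
  fixes a b S :: real
  assumes chain: "\<And>m. \<exists>ys. xs (Suc m) = xs m @ ys"
    and S: "(\<lambda>m. inv_square_sum (xs m)) \<longlonglongrightarrow> S"
    and fq: "\<And>m z. norm z < real m \<Longrightarrow> f z = zeros_prod (xs m) z * exp (q m z)"
    and q: "\<And>r. uniform_limit (cball 0 r) q (\<lambda>z. of_real b * z + of_real a * z\<^sup>2) sequentially"
    and cosh: "\<And>x::real. norm (f (of_real x)) + norm (f (of_real (- x))) \<ge> 2"
  shows "a \<ge> 0"
proof (rule ccontr)
  assume "\<not> a \<ge> 0"
  then have a: "a < 0" by simp
  have "\<forall>\<^sub>F m in sequentially. inv_square_sum (xs m) > S + a / 2"
    using a by (intro order_tendstoD(1)[OF S]) auto
  then obtain N where "S + a / 2 < inv_square_sum (xs N)"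
    using eventually_happens'[OF sequentially_bot] by blast
  then have N: "S - inv_square_sum (xs N) < - a / 2" by linarith
  define P where "P x = norm (zeros_prod (xs N) (of_real x))" for x :: real
  have bound: "norm (f (of_real x)) \<le> P x * exp (b * x + a / 2 * x\<^sup>2)" for x
  proof -
    let ?g = "\<lambda>m. P x * exp (x\<^sup>2 * (inv_square_sum (xs m) - inv_square_sum (xs N)) + Re (q m (of_real x)))"
    have "(\<lambda>m. q m (of_real x)) \<longlonglongrightarrow> of_real b * of_real x + of_real a * (of_real x)\<^sup>2"
      by (rule tendsto_uniform_limitI[OF q[of "\<bar>x\<bar>"]]) auto
    then have "(\<lambda>m. Re (q m (of_real x))) \<longlonglongrightarrow> Re (of_real b * of_real x + of_real a * (of_real x)\<^sup>2)"
      by (rule tendsto_Re)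
    also have "of_real b * of_real x + of_real a * (of_real x)\<^sup>2 = complex_of_real (b * x + a * x\<^sup>2)" by simp
    finally have "(\<lambda>m. Re (q m (of_real x))) \<longlonglongrightarrow> b * x + a * x\<^sup>2" by simp
    then have g_lim: "?g \<longlonglongrightarrow> P x * exp (x\<^sup>2 * (S - inv_square_sum (xs N)) + (b * x + a * x\<^sup>2))"
      by (intro tendsto_intros S)
    have "\<forall>\<^sub>F m in sequentially. real m > \<bar>x\<bar>"
      using filterlim_real_sequentially by (simp add: filterlim_at_top_dense)
    then have g_ge: "\<forall>\<^sub>F m in sequentially. norm (f (of_real x)) \<le> ?g m"
      using eventually_ge_at_top[of N]
    proof eventually_elim
      case (elim m)
      obtain ys where ys: "xs m = xs N @ ys" using prefix_chain[of xs N m] chain elim(2) by blast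
      have "norm (f (of_real x)) = P x * (norm (zeros_prod ys (of_real x)) * exp (Re (q m (of_real x))))"
        using fq[of "of_real x" m] elim(1) by (simp add: ys norm_mult P_def)
      also have "\<dots> \<le> P x * (exp (x\<^sup>2 * inv_square_sum ys) * exp (Re (q m (of_real x))))"
        by (intro mult_left_mono mult_right_mono norm_zeros_prod_real_le) (auto simp: P_def)
      finally show ?case by (simp add: ys exp_add)
    qed
    have "x\<^sup>2 * (S - inv_square_sum (xs N)) \<le> x\<^sup>2 * (- a / 2)"
      using N by (intro mult_left_mono) auto
    then have "x\<^sup>2 * (S - inv_square_sum (xs N)) + (b * x + a * x\<^sup>2) \<le> b * x + a / 2 * x\<^sup>2"
      by (simp add: algebra_simps)
    then have "P x * exp (x\<^sup>2 * (S - inv_square_sum (xs N)) + (b * x + a * x\<^sup>2))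
        \<le> P x * exp (b * x + a / 2 * x\<^sup>2)"
      by (intro mult_left_mono) (auto simp: P_def)
    with tendsto_lowerbound[OF g_lim g_ge sequentially_bot] show ?thesis by linarith
  qed
  have P_even: "P (- x) = P x" for x by (simp add: P_def zeros_prod_def)
  have lower: "2 \<le> P x * exp (b * x + a / 2 * x\<^sup>2) + P x * exp (- b * x + a / 2 * x\<^sup>2)" for x
    using order_trans[OF cosh[of x] add_mono[OF bound[of x] bound[of "- x"]]] by (simp add: P_even)
  have lim: "((\<lambda>x. P x * exp (\<beta> * x + a / 2 * x\<^sup>2)) \<longlongrightarrow> 0) at_top" for \<beta>
    using zeros_prod_gaussian_decay[of "- a / 2" "xs N" \<beta>] a by (simp add: P_def)
  have "2 \<le> (0 + 0 :: real)"
    by (rule tendsto_lowerbound[OF tendsto_add[OF lim[of b] lim[of "- b"]]])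
      (use lower in auto)
  then show False by simp
qed

section \<open>Turan inequalities for functions with imaginary zeros\<close>

lemma turan_seq_even_coeff_power:
  assumes "F holomorphic_on UNIV" "turan_seq (even_coeff F)" "0 \<le> \<alpha>"
  shows "turan_seq (even_coeff (\<lambda>z. (1 + of_real \<alpha> * z\<^sup>2) ^ n * F z))"
proof (induction n)
  case (Suc n)
  have "(\<lambda>z. (1 + of_real \<alpha> * z\<^sup>2) ^ n * F z) holomorphic_on UNIV"
    by (intro holomorphic_intros assms)
  from turan_seq_even_coeff_mult[OF this Suc assms(3)] show ?case by (simp add: mult_ac)
qed (use assms in simp)

lemma turan_seq_even_coeff_zeros_prod:
  assumes "F holomorphic_on UNIV" "turan_seq (even_coeff F)"
  shows "turan_seq (even_coeff (\<lambda>z. zeros_prod xs z * F z))"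
proof (induction xs)
  case (Cons x xs)
  have "(\<lambda>z. zeros_prod xs z * F z) holomorphic_on UNIV"
    by (intro holomorphic_intros assms)
  from turan_seq_even_coeff_mult[OF this Cons, of "1 / x\<^sup>2"] show ?case by (simp add: mult_ac)
qed (use assms in simp)

lemma uniform_limit_exp_to_1:
  fixes e :: "nat \<Rightarrow> complex \<Rightarrow> complex"
  assumes "uniform_limit A e (\<lambda>_. 0) sequentially"
  shows "uniform_limit A (\<lambda>m z. exp (e m z)) (\<lambda>_. 1) sequentially"
proof -
  have "uniform_limit A (\<lambda>m z. exp (e m z)) (\<lambda>_. exp 0) sequentially"
  proof (rule uniform_limit_compose_uniformly_continuous_on[OF assms])
    show "uniformly_continuous_on (cball 0 1) (exp :: complex \<Rightarrow> complex)"
      by (intro compact_uniformly_continuous continuous_intros) auto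
    show "\<forall>\<^sub>F m in sequentially. \<forall>z\<in>A. e m z \<in> cball 0 1"
      using uniform_limitD[OF assms zero_less_one] by eventually_elim (auto simp: dist_norm less_imp_le)
  qed auto
  then show ?thesis by simp
qed

lemma log_power_expansion:
  fixes a :: real
  shows "uniform_limit (cball 0 1) (\<lambda>m z. of_nat m * Ln (1 + of_real (a / real m) * z\<^sup>2))
     (\<lambda>z. of_real a * z\<^sup>2) sequentially"
proof (rule uniform_limitI)
  fix e :: real assume e: "e > 0"
  have "(\<lambda>m. 2 * a\<^sup>2 / real m) \<longlonglongrightarrow> 0" by (rule lim_const_over_n)
  then have "\<forall>\<^sub>F m in sequentially. 2 * a\<^sup>2 / real m < e" using e by (rule order_tendstoD)
  moreover have "\<forall>\<^sub>F m in sequentially. real m \<ge> 2 * \<bar>a\<bar> + 1"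
    using filterlim_real_sequentially by (simp add: filterlim_at_top)
  ultimately show "\<forall>\<^sub>F m in sequentially. \<forall>z\<in>cball 0 1.
      dist (of_nat m * Ln (1 + of_real (a / real m) * z\<^sup>2)) (of_real a * z\<^sup>2) < e"
  proof eventually_elim
    case (elim m)
    show ?case
    proof
      fix z assume "z \<in> cball (0::complex) 1"
      then have z: "norm z \<le> 1" by simp
      have m: "real m > 0" using elim(2) by linarith
      define u where "u = of_real (a / real m) * z\<^sup>2"
      have "norm u = \<bar>a\<bar> / real m * (norm z)\<^sup>2"
        using m by (simp add: u_def norm_mult norm_power norm_divide)
      also have "\<dots> \<le> \<bar>a\<bar> / real m * 1"
        using z m by (intro mult_left_mono) (auto simp: power_le_one)
      finally have u: "norm u \<le> \<bar>a\<bar> / real m" by simp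
      have "\<bar>a\<bar> / real m \<le> 1 / 2" using elim(2) m by (simp add: field_simps)
      then have u2: "norm u \<le> 1 / 2" using u by linarith
      have au: "of_real a * z\<^sup>2 = of_nat m * u" using m by (simp add: u_def)
      have "norm (Ln (1 + u) - u) \<le> (norm u)\<^sup>2 / (1 - norm u)"
        using u2 by (intro Ln_approx_linear) auto
      also have "\<dots> \<le> (\<bar>a\<bar> / real m)\<^sup>2 / (1 / 2)"
        using u u2 by (intro frac_le power_mono) auto
      finally have "real m * norm (Ln (1 + u) - u) \<le> real m * ((\<bar>a\<bar> / real m)\<^sup>2 / (1 / 2))"
        using m by (intro mult_left_mono) auto
      also have "\<dots> = 2 * a\<^sup>2 / real m" using m by (simp add: power2_eq_square)
      finally have "norm (of_nat m * Ln (1 + u) - of_nat m * u) < e"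
        using elim(1) by (simp add: right_diff_distrib[symmetric] norm_mult)
      then show "dist (of_nat m * Ln (1 + of_real (a / real m) * z\<^sup>2)) (of_real a * z\<^sup>2) < e"
        unfolding dist_norm au by (simp add: u_def)
    qed
  qed
qed

text \<open>
  The approximants are \<open>F m z = P\<^sub>m z \<cdot> (1 + a z\<^sup>2 / m)\<^sup>m \<cdot> exp (b z)\<close>, where \<open>P\<^sub>m\<close> is the product over the
  first zeros. They satisfy the inequalities by construction, and their quotient by \<open>f\<close> is the exponential
  of a function that tends to \<open>0\<close> uniformly on the unit disc.
\<close>

theorem turan_seq_even_coeff_imaginary_zeros:
  assumes f: "real_entire f" and f0: "f 0 = 1" and imag: "\<And>z. f z = 0 \<Longrightarrow> Re z = 0"
    and growth: "gaussian_growth f"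
    and cosh: "\<And>x::real. norm (f (of_real x)) + norm (f (of_real (- x))) \<ge> 2"
  shows "turan_seq (even_coeff f)"
proof -
  obtain xs q S a b where chain: "\<And>m. \<exists>ys. xs (Suc m) = xs m @ ys"
    and S: "(\<lambda>m. inv_square_sum (xs m)) \<longlonglongrightarrow> S"
    and fq: "\<And>m z. norm z < real m \<Longrightarrow> f z = zeros_prod (xs m) z * exp (q m z)"
    and q: "\<And>r. uniform_limit (cball 0 r) q (\<lambda>z. of_real b * z + of_real a * z\<^sup>2) sequentially"
    by (rule imaginary_zeros_factorization[OF f f0 imag growth], assumption, (rule that; assumption))
  have a: "a \<ge> 0" by (rule quadratic_exponent_nonneg[OF chain S fq q cosh])
  define F where "F m z = zeros_prod (xs m) z *
      ((1 + of_real (a / real m) * z\<^sup>2) ^ m * exp (of_real b * z))" for m z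
  have F_holo: "F m holomorphic_on UNIV" for m
    unfolding F_def[abs_def] by (intro holomorphic_intros)
  have "turan_seq (even_coeff (\<lambda>z. exp (of_real b * z)))"
    unfolding even_coeff_exp[abs_def] by (intro turan_seq_exp) simp
  then have F_turan: "turan_seq (even_coeff (F m))" for m
    unfolding F_def[abs_def] using a
    by (intro turan_seq_even_coeff_zeros_prod turan_seq_even_coeff_power holomorphic_intros) auto
  define e where "e m z = of_real b * z - q m z + of_nat m * Ln (1 + of_real (a / real m) * z\<^sup>2)" for m z
  have "uniform_limit (cball 0 1) e
      (\<lambda>z. of_real b * z - (of_real b * z + of_real a * z\<^sup>2) + of_real a * z\<^sup>2) sequentially"
    unfolding e_def[abs_def]
    by (intro uniform_limit_intros log_power_expansion q)
  then have "uniform_limit (cball 0 1) e (\<lambda>_. 0) sequentially" by simp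
  then have "uniform_limit (cball 0 1) (\<lambda>m z. exp (e m z)) (\<lambda>_. 1) sequentially"
    by (rule uniform_limit_exp_to_1)
  moreover have "compact (f ` cball 0 1)"
    using f by (intro compact_continuous_image holomorphic_on_imp_continuous_on)
      (auto simp: real_entire_def intro: holomorphic_on_subset)
  ultimately have "uniform_limit (cball 0 1) (\<lambda>m z. f z * exp (e m z)) (\<lambda>z. f z * 1) sequentially"
    by (intro uniform_lim_mult uniform_limit_const)
      (auto intro: compact_imp_bounded simp: image_constant_conv)
  moreover have "\<forall>\<^sub>F m in sequentially. \<forall>z\<in>cball 0 1. f z * exp (e m z) = F m z"
  proof -
    have "\<forall>\<^sub>F m in sequentially. real m \<ge> a + 2"
      using filterlim_real_sequentially by (simp add: filterlim_at_top)
    then show ?thesis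
    proof eventually_elim
      case (elim m)
      show ?case
      proof
        fix z assume "z \<in> cball (0::complex) 1"
        then have z: "norm z \<le> 1" by simp
        have m: "real m > 0" using elim a by linarith
        have "norm (of_real (a / real m) * z\<^sup>2) = a / real m * (norm z)\<^sup>2"
          using m a by (simp add: norm_mult norm_power norm_divide)
        also have "\<dots> \<le> a / real m * 1"
          using z m a by (intro mult_left_mono) (auto simp: power_le_one)
        also have "\<dots> < 1" using elim m by (simp add: field_simps)
        finally have nz: "1 + of_real (a / real m) * z\<^sup>2 \<noteq> 0"
          by (metis add_eq_0_iff norm_minus_cancel norm_one less_irrefl)
        have "f z * exp (e m z) = zeros_prod (xs m) z * (exp (q m z) * exp (e m z))"
          using fq[of z m] z elim a by simp
        also have "exp (q m z) * exp (e m z) =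
            exp (of_nat m * Ln (1 + of_real (a / real m) * z\<^sup>2)) * exp (of_real b * z)"
          unfolding exp_add[symmetric] by (simp add: e_def algebra_simps)
        also have "exp (of_nat m * Ln (1 + of_real (a / real m) * z\<^sup>2)) = (1 + of_real (a / real m) * z\<^sup>2) ^ m"
          unfolding exp_of_nat_mult exp_Ln[OF nz] ..
        finally show "f z * exp (e m z) = F m z" by (simp add: F_def)
      qed
    qed
  qed
  ultimately have "uniform_limit (cball 0 1) F f sequentially"
    by (subst (asm) uniform_limit_cong[where g = F and i = f]) auto
  from turan_seq_limit[OF F_turan even_coeff_uniform_limit[OF this F_holo]]
  show ?thesis .
qed

section \<open>The moment generating function\<close>

lemma complex_mgf_integrable_exp_abs:
  assumes "gaussian_mgf_bound M X" and X: "X \<in> borel_measurable M"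
  shows "integrable M (\<lambda>\<omega>. exp (t * \<bar>X \<omega>\<bar>))"
proof -
  have I: "integrable M (\<lambda>\<omega>. exp (s * X \<omega>))" for s :: real
  proof -
    have "integrable M (\<lambda>\<omega>. exp (of_real s * complex_of_real (X \<omega>)))"
      using assms(1) unfolding gaussian_mgf_bound_def by blast
    from integrable_norm[OF this] show ?thesis by simp
  qed
  show ?thesis
  proof (rule Bochner_Integration.integrable_bound[OF Bochner_Integration.integrable_add[OF I[of t] I[of "- t"]]])
    show "AE \<omega> in M. norm (exp (t * \<bar>X \<omega>\<bar>)) \<le> norm (exp (t * X \<omega>) + exp (- t * X \<omega>))"
    proof (intro AE_I2)
      fix \<omega>
      have "exp (t * \<bar>X \<omega>\<bar>) \<le> exp (t * X \<omega>) + exp (- t * X \<omega>)"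
        by (cases "X \<omega> \<ge> 0") (simp_all add: abs_if)
      then show "norm (exp (t * \<bar>X \<omega>\<bar>)) \<le> norm (exp (t * X \<omega>) + exp (- t * X \<omega>))"
        by simp
    qed
  qed (use X in measurable)
qed

lemma (in prob_space) moments_integrable:
  assumes "gaussian_mgf_bound M X" and X: "X \<in> borel_measurable M"
  shows "integrable M (\<lambda>\<omega>. X \<omega> ^ k)"
proof (rule Bochner_Integration.integrable_bound)
  show "integrable M (\<lambda>\<omega>. fact k * exp (1 * \<bar>X \<omega>\<bar>))"
    by (intro integrable_mult_right complex_mgf_integrable_exp_abs[OF assms])
  show "AE \<omega> in M. norm (X \<omega> ^ k) \<le> norm (fact k * exp (1 * \<bar>X \<omega>\<bar>))"
  proof (intro AE_I2)
    fix \<omega>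
    have "\<bar>X \<omega>\<bar> ^ k / fact k \<le> exp \<bar>X \<omega>\<bar>"
      using sum_le_suminf[OF summable_exp_generic[of "\<bar>X \<omega>\<bar>"], of "{k}"]
      by (simp add: exp_def divide_inverse mult.commute)
    then have "\<bar>X \<omega>\<bar> ^ k \<le> fact k * exp \<bar>X \<omega>\<bar>"
      by (simp add: divide_le_eq mult.commute)
    then show "norm (X \<omega> ^ k) \<le> norm (fact k * exp (1 * \<bar>X \<omega>\<bar>))"
      by (simp add: power_abs)
  qed
qed (use X in measurable)

lemma (in prob_space) complex_mgf_power_series:
  assumes "gaussian_mgf_bound M X" and X: "X \<in> borel_measurable M"
  shows "(\<lambda>n. of_real (expectation (\<lambda>\<omega>. X \<omega> ^ n) / fact n) * z ^ n) sums complex_mgf M X z"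
proof -
  define s where "s N \<omega> = (\<Sum>n<N. of_real (X \<omega> ^ n / fact n) * z ^ n)" for N \<omega>
  have int: "integrable M (\<lambda>\<omega>. complex_of_real (X \<omega> ^ n / fact n) * z ^ n)" for n
    by (intro integrable_mult_left integrable_of_real integrable_divide moments_integrable[OF assms])
  have s_int: "integral\<^sup>L M (s N) = (\<Sum>n<N. of_real (expectation (\<lambda>\<omega>. X \<omega> ^ n) / fact n) * z ^ n)" for N
    unfolding s_def
    by (subst Bochner_Integration.integral_sum, rule int)
      (simp only: integral_mult_left_zero integral_complex_of_real integral_divide_zero)
  have term_eq: "complex_of_real (X \<omega> ^ n / fact n) * z ^ n = (z * of_real (X \<omega>)) ^ n /\<^sub>R fact n" for n \<omega>
    by (simp add: scaleR_conv_of_real power_mult_distrib field_simps)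
  have "(\<lambda>N. integral\<^sup>L M (s N)) \<longlonglongrightarrow> (\<integral>\<omega>. exp (z * of_real (X \<omega>)) \<partial>M)"
  proof (rule integral_dominated_convergence[where w = "\<lambda>\<omega>. exp (norm z * \<bar>X \<omega>\<bar>)"])
    show "integrable M (\<lambda>\<omega>. exp (norm z * \<bar>X \<omega>\<bar>))"
      by (rule complex_mgf_integrable_exp_abs[OF assms])
    show "(\<lambda>\<omega>. exp (z * of_real (X \<omega>))) \<in> borel_measurable M" using X by measurable
    show "s N \<in> borel_measurable M" for N
      unfolding s_def[abs_def] by (intro borel_measurable_sum borel_measurable_integrable int)
    show "AE \<omega> in M. (\<lambda>N. s N \<omega>) \<longlonglongrightarrow> exp (z * of_real (X \<omega>))"
      unfolding s_def term_eq using exp_converges by (auto simp: sums_def)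
    show "AE \<omega> in M. norm (s N \<omega>) \<le> exp (norm z * \<bar>X \<omega>\<bar>)" for N
    proof (intro AE_I2)
      fix \<omega>
      have "norm (s N \<omega>) \<le> (\<Sum>n<N. norm ((z * of_real (X \<omega>)) ^ n /\<^sub>R fact n))"
        unfolding s_def term_eq by (rule norm_sum)
      also have "\<dots> = (\<Sum>n<N. (norm z * \<bar>X \<omega>\<bar>) ^ n /\<^sub>R fact n)"
        by (simp add: norm_power norm_mult)
      also have "\<dots> \<le> (\<Sum>n. (norm z * \<bar>X \<omega>\<bar>) ^ n /\<^sub>R fact n)"
        by (intro sum_le_suminf summable_exp_generic) auto
      finally show "norm (s N \<omega>) \<le> exp (norm z * \<bar>X \<omega>\<bar>)" by (simp add: exp_def)
    qed
  qed
  then show ?thesis unfolding sums_def complex_mgf_def s_int .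
qed

lemma real_entire_complex_mgf:
  assumes "prob_space M" "gaussian_mgf_bound M X" "X \<in> borel_measurable M"
  shows "real_entire (complex_mgf M X)"
  unfolding real_entire_def
proof (intro conjI allI)
  interpret prob_space M by fact
  have "complex_mgf M X field_differentiable at z" for z
  proof -
    have "complex_mgf M X holomorphic_on ball 0 (norm z + 1)"
      by (rule power_series_holomorphic[where a = "\<lambda>n. of_real (expectation (\<lambda>\<omega>. X \<omega> ^ n) / fact n)"])
        (use complex_mgf_power_series[OF assms(2,3)] in simp)
    then show ?thesis by (rule holomorphic_on_imp_differentiable_at) auto
  qed
  then show "complex_mgf M X holomorphic_on UNIV" by (simp add: holomorphic_on_def)
  show "complex_mgf M X (cnj z) = cnj (complex_mgf M X z)" for z
    unfolding complex_mgf_def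
    by (subst Bochner_Integration.integral_cnj[symmetric]) (simp add: exp_cnj)
qed

lemma (in prob_space) even_coeff_complex_mgf:
  assumes "gaussian_mgf_bound M X" "X \<in> borel_measurable M"
  shows "even_coeff (complex_mgf M X) n = fact n / fact (2 * n) * expectation (\<lambda>\<omega>. X \<omega> ^ (2 * n))"
proof -
  have "complex_mgf M X has_fps_expansion Abs_fps (\<lambda>n. of_real (expectation (\<lambda>\<omega>. X \<omega> ^ n) / fact n))"
    by (rule has_fps_expansionI, rule always_eventually)
      (use complex_mgf_power_series[OF assms] in simp)
  from fps_expansion_eqI[OF this] show ?thesis
    unfolding even_coeff_def by (simp del: of_real_divide)
qed

lemma gaussian_moment_ratio_eq:
  assumes "prob_space M" "gaussian_mgf_bound M X" "X \<in> borel_measurable M"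
  shows "gaussian_moment_ratio M X n = 2 ^ n * even_coeff (complex_mgf M X) n"
proof -
  interpret prob_space M by fact
  have "(\<integral>x. x ^ (2 * n) \<partial>std_normal_distribution) = (\<integral>x. std_normal_density x * x ^ (2 * n) \<partial>lborel)"
    by (subst integral_density) auto
  then show ?thesis
    unfolding gaussian_moment_ratio_def even_coeff_complex_mgf[OF assms(2,3)]
    by (simp add: integral_std_normal_moment_even)
qed

lemma (in prob_space) norm_complex_mgf_sum_ge_2:
  assumes "gaussian_mgf_bound M X"
  shows "norm (complex_mgf M X (of_real x)) + norm (complex_mgf M X (of_real (- x))) \<ge> 2"
proof -
  have I: "integrable M (\<lambda>\<omega>. exp (of_real s * complex_of_real (X \<omega>)))" for s
    using assms unfolding gaussian_mgf_bound_def by blast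
  have I': "integrable M (\<lambda>\<omega>. exp (s * X \<omega>))" for s
    using integrable_norm[OF I[of s]] by simp
  have R: "Re (complex_mgf M X (of_real s)) = expectation (\<lambda>\<omega>. exp (s * X \<omega>))" for s
    unfolding complex_mgf_def using integral_Re[OF I[of s]] by (simp add: Re_exp)
  have "2 = expectation (\<lambda>\<omega>. 2 :: real)" by (simp add: prob_space)
  also have "\<dots> \<le> expectation (\<lambda>\<omega>. exp (x * X \<omega>) + exp (- x * X \<omega>))"
  proof (rule integral_mono)
    fix \<omega>
    show "2 \<le> exp (x * X \<omega>) + exp (- x * X \<omega>)"
      using exp_ge_add_one_self[of "x * X \<omega>"] exp_ge_add_one_self[of "- (x * X \<omega>)"]
      unfolding mult_minus_left by linarith
  qed (use I'[of x] I'[of "- x"] in simp_all)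
  also have "\<dots> = Re (complex_mgf M X (of_real x)) + Re (complex_mgf M X (of_real (- x)))"
    using I'[of x] I'[of "- x"] by (simp add: R[of x] R[of "- x", simplified])
  finally show ?thesis
    using complex_Re_le_cmod[of "complex_mgf M X (of_real x)"]
      complex_Re_le_cmod[of "complex_mgf M X (of_real (- x))"] by linarith
qed

lemma (in prob_space) complex_mgf_0 [simp]: "complex_mgf M X 0 = 1"
  by (simp add: complex_mgf_def prob_space)

text \<open>
  A vanishing even moment of positive order makes \<open>X\<close> vanish almost surely. The case \<open>j = 0\<close> is harmless,
  since the moment of order zero is \<open>1\<close>.
\<close>

lemma (in prob_space) even_moment_support:
  assumes "gaussian_mgf_bound M X" "X \<in> borel_measurable M"
    and "expectation (\<lambda>\<omega>. X \<omega> ^ (2 * j)) = 0" "k > 0"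
  shows "expectation (\<lambda>\<omega>. X \<omega> ^ (2 * k)) = 0"
proof -
  have "AE \<omega> in M. X \<omega> ^ (2 * j) = 0"
    using assms(3) integral_nonneg_eq_0_iff_AE[OF moments_integrable[OF assms(1,2)], of "2 * j"]
    by (simp add: power_mult)
  then have "AE \<omega> in M. X \<omega> ^ (2 * k) = 0" 
    by eventually_elim (use assms(4) in auto)
  then show ?thesis by (rule integral_eq_zero_AE)
qed

section \<open>Log-concavity of the normalized moments\<close>

theorem log_concave_gaussian_moment_ratio:
  assumes M: "prob_space M" and X: "X \<in> borel_measurable M" and L: "type_L' M X"
  shows "log_concave_seq (gaussian_moment_ratio M X)"
proof -
  interpret prob_space M by fact
  have g: "gaussian_mgf_bound M X" and imag: "\<And>z. complex_mgf M X z = 0 \<Longrightarrow> Re z = 0"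
    using L by (auto simp: type_L'_def)
  define v where "v = even_coeff (complex_mgf M X)"
  have r: "gaussian_moment_ratio M X n = 2 ^ n * v n" for n
    unfolding v_def by (rule gaussian_moment_ratio_eq[OF M g X])
  have "gaussian_growth (complex_mgf M X)"
    using g unfolding gaussian_growth_def gaussian_mgf_bound_def by blast
  then have v: "turan_seq v" unfolding v_def
    by (intro turan_seq_even_coeff_imaginary_zeros real_entire_complex_mgf[OF M g X] imag
        norm_complex_mgf_sum_ge_2[OF g]) auto
  show ?thesis unfolding log_concave_seq_def
  proof (intro conjI allI impI)
    show "0 \<le> gaussian_moment_ratio M X n" for n using turan_seqD(1)[OF v] by (simp add: r)
  next
    fix i j k :: nat
    assume ij: "i \<le> j" "j \<le> k" and nz: "gaussian_moment_ratio M X i \<noteq> 0" "gaussian_moment_ratio M X k \<noteq> 0"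
    have m: "v n = 0 \<longleftrightarrow> expectation (\<lambda>\<omega>. X \<omega> ^ (2 * n)) = 0" for n
      by (simp add: v_def even_coeff_complex_mgf[OF g X])
    show "gaussian_moment_ratio M X j \<noteq> 0"
    proof (cases "k > 0")
      case True
      then show ?thesis using even_moment_support[OF g X, of j k] nz(2) by (auto simp: r m)
    next
      case False
      then show ?thesis using ij nz by simp
    qed
  next
    fix n :: nat assume "1 \<le> n"
    then obtain k where n: "n = Suc k" by (cases n) auto
    have p: "(2::real) ^ k * 2 ^ (k + 2) = 2 ^ (k + 1) * 2 ^ (k + 1)" by simp
    have "(2 ^ k * 2 ^ (k + 2)) * (v k * v (k + 2)) \<le> (2 ^ k * 2 ^ (k + 2)) * (v (k + 1) * v (k + 1))"
      using turan_seqD(2)[OF v order_refl, of k] by (intro mult_left_mono) auto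
    also have "\<dots> = (2 ^ (k + 1) * v (k + 1))\<^sup>2"
      unfolding p power2_eq_square by (simp only: mult_ac)
    finally have "(2 ^ k * v k) * (2 ^ (k + 2) * v (k + 2)) \<le> (2 ^ (k + 1) * v (k + 1))\<^sup>2"
      by (simp only: mult_ac)
    moreover have "n - 1 = k" "n + 1 = k + 2" "n = k + 1" using n by auto
    ultimately show "gaussian_moment_ratio M X (n - 1) * gaussian_moment_ratio M X (n + 1)
        \<le> (gaussian_moment_ratio M X n)\<^sup>2"
      by (simp only: r)
  qed
qed

lemma distr_uminus_eq_of_even_mgf:
  assumes M: "prob_space M" and X: "X \<in> borel_measurable M"
    and even: "\<And>z. complex_mgf M X (- z) = complex_mgf M X z"
  shows "distr M borel (\<lambda>\<omega>. - X \<omega>) = distr M borel X"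
proof (rule Levy_uniqueness)
  interpret prob_space M by fact
  show "real_distribution (distr M borel (\<lambda>\<omega>. - X \<omega>))" "real_distribution (distr M borel X)"
    using X by (auto intro!: real_distribution_distr)
  have char: "char (distr M borel Y) t = (\<integral>\<omega>. iexp (t * Y \<omega>) \<partial>M)" if "Y \<in> borel_measurable M" for Y t
    unfolding char_def using that by (subst integral_distr) auto
  show "char (distr M borel (\<lambda>\<omega>. - X \<omega>)) = char (distr M borel X)"
  proof
    fix t
    have "(\<integral>\<omega>. iexp (t * - X \<omega>) \<partial>M) = (\<integral>\<omega>. iexp (t * X \<omega>) \<partial>M)"
      using even[of "\<i> * of_real t"] by (simp add: complex_mgf_def mult.assoc)
    then show "char (distr M borel (\<lambda>\<omega>. - X \<omega>)) t = char (distr M borel X) t"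
      using X by (simp add: char)
  qed
qed

theorem theorem7:
  fixes M :: "'a measure" and X :: "'a \<Rightarrow> real"
  assumes "prob_space M"
    and "X \<in> borel_measurable M"
  shows "(type_L' M X \<longrightarrow> log_concave_seq (gaussian_moment_ratio M X)) \<and>
         (type_L M X \<longrightarrow> ultra_sub_gaussian M X)"
proof (intro conjI impI)
  interpret prob_space M by fact
  show "log_concave_seq (gaussian_moment_ratio M X)" if "type_L' M X"
    using log_concave_gaussian_moment_ratio[OF assms that] .
  assume L: "type_L M X"
  then have g: "gaussian_mgf_bound M X" and L': "type_L' M X"
    by (auto simp: type_L_def type_L'_def)
  have "gaussian_moment_ratio M X 0 = 1"
    using gaussian_moment_ratio_eq[OF assms(1) g assms(2), of 0] even_coeff_complex_mgf[OF g assms(2), of 0]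
    by (simp add: prob_space)
  then have "(\<lambda>n. if n = 0 then 1 else gaussian_moment_ratio M X n) = gaussian_moment_ratio M X"
    by auto
  then show "ultra_sub_gaussian M X"
    unfolding ultra_sub_gaussian_def
    using log_concave_gaussian_moment_ratio[OF assms L'] moments_integrable[OF g assms(2)]
      distr_uminus_eq_of_even_mgf[OF assms] L by (simp add: type_L_def)
qed

end
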